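(* Let $G=(L,R,E)$ be a bipartite graph with $|L|=|R|=m$, $n=|E|$, $T=\lceil\log_2 n\rceil$, and pairwise disjoint $S_1,\dots,S_T\subseteq E$. If there exists a $1$-valid perfect matching, then for any $\delta,\epsilon\in(0,1)$ there is an $O(n^{18/(\delta\epsilon)})$-time algorithm that outputs a $(2+\delta)$-valid $\epsilon$-nearly matching.
   Context: A set $D\subseteq E$ is $c$-valid if $|D\cap S_i|\le c\cdot2^i$ for all $1\le i\le T$ (and it is a solution of the respective problem). An $\epsilon$-nearly matching is a matching $S\subseteq E$ with at least $(1-\epsilon)m$ edges. *)

theory Defs
  imports Complex_Main "HOL-Library.Landau_Symbols" "HOL-Library.Disjoint_Sets"
begin

section \<open>Bipartite graphs and matchings\<close>

text \<open>An edge is the pair consisting of its left and its right endpoint.\<close>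

definition bipartite_graph :: "'v set \<Rightarrow> 'v set \<Rightarrow> ('v \<times> 'v) set \<Rightarrow> bool" where
  "bipartite_graph L R E \<longleftrightarrow> finite L \<and> finite R \<and> L \<inter> R = {} \<and> E \<subseteq> L \<times> R"

definition matching :: "('v \<times> 'v) set \<Rightarrow> ('v \<times> 'v) set \<Rightarrow> bool" where
  "matching E M \<longleftrightarrow>
     M \<subseteq> E \<and> (\<forall>e\<in>M. \<forall>f\<in>M. e \<noteq> f \<longrightarrow> fst e \<noteq> fst f \<and> snd e \<noteq> snd f)"

definition perfect_matching ::
  "'v set \<Rightarrow> 'v set \<Rightarrow> ('v \<times> 'v) set \<Rightarrow> ('v \<times> 'v) set \<Rightarrow> bool" where
  "perfect_matching L R E M \<longleftrightarrow> matching E M \<and> fst ` M = L \<and> snd ` M = R"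

definition nearly_matching :: "real \<Rightarrow> nat \<Rightarrow> ('v \<times> 'v) set \<Rightarrow> ('v \<times> 'v) set \<Rightarrow> bool" where
  "nearly_matching \<epsilon> m E M \<longleftrightarrow> matching E M \<and> (1 - \<epsilon>) * real m \<le> real (card M)"

definition valid :: "real \<Rightarrow> nat \<Rightarrow> (nat \<Rightarrow> 'e set) \<Rightarrow> 'e set \<Rightarrow> bool" where
  "valid c T S D \<longleftrightarrow> (\<forall>i\<in>{1..T}. real (card (D \<inter> S i)) \<le> c * 2 ^ i)"


section \<open>A word RAM\<close>

text \<open>
  Algorithms are structured programs for a word RAM with word length \<open>w\<close>. The machine has
  registers (a program mentions only finitely many of them) and a random-access memory; both
  hold words, i.e. natural numbers below \<open>2 ^ w\<close>, and results of arithmetic are reduced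
  modulo \<open>2 ^ w\<close>. Subtraction is truncated at 0, and \<open>Less\<close> yields 1 or 0.
\<close>

datatype binop = Add | Sub | Mul | Div | Mod | Less

datatype expr =
    Lit nat
  | Reg nat
  | Mem expr
  | Op binop expr expr

datatype prog =
    Skip
  | Assign nat expr
  | Store expr expr
  | Seq prog prog
  | Cond expr prog prog
  | While expr prog

type_synonym state = "(nat \<Rightarrow> nat) \<times> (nat \<Rightarrow> nat)"

primrec apply_op :: "binop \<Rightarrow> nat \<Rightarrow> nat \<Rightarrow> nat" where
  "apply_op Add x y = x + y"
| "apply_op Sub x y = x - y"
| "apply_op Mul x y = x * y"
| "apply_op Div x y = x div y"
| "apply_op Mod x y = x mod y"
| "apply_op Less x y = (if x < y then 1 else 0)"

primrec expr_val :: "nat \<Rightarrow> state \<Rightarrow> expr \<Rightarrow> nat" where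
  "expr_val w s (Lit c) = c mod 2 ^ w"
| "expr_val w s (Reg r) = fst s r"
| "expr_val w s (Mem e) = snd s (expr_val w s e)"
| "expr_val w s (Op f e1 e2) = apply_op f (expr_val w s e1) (expr_val w s e2) mod 2 ^ w"

primrec expr_time :: "expr \<Rightarrow> nat" where
  "expr_time (Lit c) = 1"
| "expr_time (Reg r) = 1"
| "expr_time (Mem e) = expr_time e + 1"
| "expr_time (Op f e1 e2) = expr_time e1 + expr_time e2 + 1"

text \<open>
  \<open>exec w P s t s'\<close>: with word length \<open>w\<close>, the program \<open>P\<close> started in state \<open>s\<close> halts in state
  \<open>s'\<close> after \<open>t\<close> time units. Every evaluation of an expression node, every write and every
  test costs one unit.
\<close>

inductive exec :: "nat \<Rightarrow> prog \<Rightarrow> state \<Rightarrow> nat \<Rightarrow> state \<Rightarrow> bool" for w :: nat where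
  exec_Skip: "exec w Skip s 1 s"
| exec_Assign:
    "exec w (Assign r e) s (expr_time e + 1) ((fst s)(r := expr_val w s e), snd s)"
| exec_Store:
    "exec w (Store a e) s (expr_time a + expr_time e + 1)
       (fst s, (snd s)(expr_val w s a := expr_val w s e))"
| exec_Seq:
    "exec w P s t1 s' \<Longrightarrow> exec w Q s' t2 s'' \<Longrightarrow> exec w (Seq P Q) s (t1 + t2) s''"
| exec_Cond_true:
    "expr_val w s b \<noteq> 0 \<Longrightarrow> exec w P s t s' \<Longrightarrow>
       exec w (Cond b P Q) s (expr_time b + 1 + t) s'"
| exec_Cond_false:
    "expr_val w s b = 0 \<Longrightarrow> exec w Q s t s' \<Longrightarrow>
       exec w (Cond b P Q) s (expr_time b + 1 + t) s'"
| exec_While_false: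
    "expr_val w s b = 0 \<Longrightarrow> exec w (While b P) s (expr_time b + 1) s"
| exec_While_true:
    "expr_val w s b \<noteq> 0 \<Longrightarrow> exec w P s t1 s' \<Longrightarrow> exec w (While b P) s' t2 s'' \<Longrightarrow>
       exec w (While b P) s (expr_time b + 1 + t1 + t2) s''"

inductive_cases exec_SkipE: "exec w Skip s t s'"
inductive_cases exec_AssignE: "exec w (Assign r e) s t s'"
inductive_cases exec_StoreE: "exec w (Store a e) s t s'"
inductive_cases exec_SeqE: "exec w (Seq P Q) s t s'"
inductive_cases exec_CondE: "exec w (Cond b P Q) s t s'"
inductive_cases exec_WhileE: "exec w (While b P) s t s'"

lemma exec_deterministic:
  "exec w P s t s' \<Longrightarrow> exec w P s u s'' \<Longrightarrow> u = t \<and> s'' = s'"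
proof (induction arbitrary: u s'' rule: exec.induct)
  case (exec_Skip s)
  from exec_Skip.prems show ?case by (rule exec_SkipE) simp
next
  case (exec_Assign r e s)
  from exec_Assign.prems show ?case by (rule exec_AssignE) simp
next
  case (exec_Store a e s)
  from exec_Store.prems show ?case by (rule exec_StoreE) simp
next
  case (exec_Seq P s t1 s1 Q t2 s2)
  from exec_Seq.prems show ?case by (rule exec_SeqE) (use exec_Seq.IH in metis)
next
  case (exec_Cond_true s b P t s1 Q)
  from exec_Cond_true.prems show ?case
    by (rule exec_CondE) (use exec_Cond_true.hyps in \<open>auto dest!: exec_Cond_true.IH\<close>)
next
  case (exec_Cond_false s b Q t s1 P)
  from exec_Cond_false.prems show ?case
    by (rule exec_CondE) (use exec_Cond_false.hyps in \<open>auto dest!: exec_Cond_false.IH\<close>)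
next
  case (exec_While_false s b P)
  from exec_While_false.prems show ?case
    by (rule exec_WhileE) (use exec_While_false.hyps in simp_all)
next
  case (exec_While_true s b P t1 s1 t2 s2)
  from exec_While_true.prems exec_While_true.hyps(1) obtain s' u1 u2
    where "exec w P s u1 s'" "exec w (While b P) s' u2 s''" "u = expr_time b + 1 + u1 + u2"
    by (auto elim: exec_WhileE)
  then show ?case using exec_While_true.IH by metis
qed

text \<open>
  Words have \<open>O(log n)\<close> bits on instances of size \<open>n\<close>; as usual, the constant \<open>k\<close> may depend
  on the algorithm. The summand 2 keeps words nonempty for every \<open>n\<close> (if \<open>k > 0\<close>).
\<close>

definition word_length :: "nat \<Rightarrow> nat \<Rightarrow> nat" where
  "word_length k n = k * nat \<lceil>log 2 (real n + 2)\<rceil>"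

definition initial_state :: "nat list \<Rightarrow> state" where
  "initial_state xs = (\<lambda>_. 0, \<lambda>a. if a < length xs then xs ! a else 0)"


section \<open>Input and output\<close>

definition enumerates :: "'a list \<Rightarrow> 'a set \<Rightarrow> bool" where
  "enumerates xs A \<longleftrightarrow> distinct xs \<and> set xs = A"

definition position :: "'a list \<Rightarrow> 'a \<Rightarrow> nat" where
  "position xs x = (THE i. i < length xs \<and> xs ! i = x)"

text \<open>The number of the set containing \<open>e\<close>, or 0 if there is none; meant for disjoint sets.\<close>

definition set_number :: "nat \<Rightarrow> (nat \<Rightarrow> 'e set) \<Rightarrow> 'e \<Rightarrow> nat" where
  "set_number T S e =
     (if \<exists>i\<in>{1..T}. e \<in> S i then THE i. i \<in> {1..T} \<and> e \<in> S i else 0)"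

text \<open>
  The graph is presented as an edge list: the lists \<open>us\<close>, \<open>vs\<close> and \<open>es\<close> enumerate \<open>L\<close>, \<open>R\<close> and
  \<open>E\<close> in any order. The input consists of \<open>|L|\<close>, \<open>|E|\<close> and, for each edge, the numbers of its
  left endpoint, of its right endpoint and of the set \<open>S i\<close> that contains it.
\<close>

definition encode_instance ::
  "'v list \<Rightarrow> 'v list \<Rightarrow> ('v \<times> 'v) list \<Rightarrow> nat \<Rightarrow> (nat \<Rightarrow> ('v \<times> 'v) set) \<Rightarrow> nat list" where
  "encode_instance us vs es T S =
     [length us, length es] @
     concat (map (\<lambda>e. [position us (fst e), position vs (snd e), set_number T S e]) es)"

text \<open>On termination, memory cell \<open>j\<close> is nonzero iff the \<open>j\<close>-th edge is selected.\<close>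

definition output_edges :: "'e list \<Rightarrow> state \<Rightarrow> 'e set" where
  "output_edges es s = {es ! j | j. j < length es \<and> snd s j \<noteq> 0}"

end

theory Submission
  imports Defs "HOL-Combinatorics.Permutations" "HOL-Real_Asymp.Real_Asymp"
begin

text \<open>
  Local search: toggle at most \<open>K\<close> edges whenever this increases
  \<open>2 ^ T * card M - (\<Sum>i. 2 ^ (T - i) * (card (M \<inter> S i) - 2 ^ i)\<^sup>2)\<close>, with truncated
  subtraction inside the square. In a local optimum, removing one edge does not pay, so every
  \<open>S i\<close> is loaded at most twice. To bound the size, compare with the perfect matching: switching
  along windows of \<open>q\<close> consecutive edges of the alternating paths and cycles, weighted so that
  every edge is added once, shows that a local optimum misses at most a \<open>1 / q\<close> fraction plus
  \<open>O(q T)\<close> edges, the latter coming from the second-order terms of the penalty. As \<open>n \<le> m\<^sup>2\<close>,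
  this is at most \<open>\<epsilon> m\<close> for \<open>q \<approx> 2 / \<epsilon>\<close> and large \<open>n\<close>; for the finitely many small \<open>n\<close>,
  taking \<open>K \<ge> n\<close> makes local optima global. The moves are enumerated as the \<open>K\<close>-digit numbers
  in base \<open>n + 1\<close> with \<open>K = 3 q\<close>, which dominates the running time \<open>O(n ^ (3 q + 4))\<close>.
\<close>

section \<open>Windows along the orbits of a permutation\<close>

text \<open>No single window can be trusted to relieve every overfull \<open>S i\<close>, so the
  loads enter the objective as a smooth penalty instead of hard constraints: the first-order change
  is linear in the switch and can be averaged over all windows, where only the total loads of the
  two matchings matter. The weight \<open>2 ^ (T - i)\<close> measures excess relative to the
  capacity \<open>2 ^ i\<close>. It also makes the second-order error of a set independent of
  \<open>i\<close>: weight \<open>2 ^ (T - i)\<close>, times \<open>O(q)\<close> changes per switch,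
  times \<open>O(2 ^ i)\<close> changes on weighted average, gives \<open>O(q) * 2 ^ T\<close>, the
  value of \<open>O(q)\<close> edges. The potential is an integer of size at most
  \<open>2 ^ T * n = O(n ^ 2)\<close>, which bounds the number of improvements. Between two of them
  at most \<open>(n + 1) ^ K\<close> moves are tried, each evaluated in time
  \<open>O(n ^ 2)\<close>; these two squares are the 4 in the exponent.\<close>

definition window :: "('a \<Rightarrow> 'a) \<Rightarrow> nat \<Rightarrow> 'a \<Rightarrow> 'a set" where
  "window \<pi> q u = (\<lambda>k. (\<pi> ^^ k) u) ` {..<q}"

lemma finite_window [simp]: "finite (window \<pi> q u)"
  by (simp add: window_def)

lemma card_window_le: "card (window \<pi> q u) \<le> q"
  unfolding window_def using card_image_le[of "{..<q}"] by simp

lemma window_self: "q \<ge> 1 \<Longrightarrow> u \<in> window \<pi> q u"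
  unfolding window_def by (rule image_eqI[of _ _ 0]) auto

lemma window_step: "window \<pi> q (\<pi> u) = \<pi> ` window \<pi> q u"
  unfolding window_def by (auto simp: funpow_swap1 image_image)

lemma card_window_funpow:
  assumes "inj \<pi>"
  shows "card (window \<pi> q ((\<pi> ^^ k) u)) = card (window \<pi> q u)"
proof (induction k)
  case (Suc k)
  then show ?case
    using card_image[OF inj_on_subset[OF assms], of "window \<pi> q ((\<pi> ^^ k) u)"]
    by (simp add: window_step)
qed auto

text \<open>The windows containing \<open>x\<close> start at \<open>x\<close> or at one of its
  \<open>q - 1\<close> predecessors. Shifting these starts forward by \<open>q - 1\<close> steps
  turns them into the window of \<open>x\<close>, also when the orbit is shorter than
  \<open>q\<close>, so that counting them needs no case distinction.\<close>

lemma funpow_image_window_starts: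
  assumes "bij \<pi>" "q \<ge> 1"
  shows "(\<pi> ^^ (q - 1)) ` {u. x \<in> window \<pi> q u} = window \<pi> q x"
proof (intro equalityI subsetI)
  fix y assume "y \<in> (\<pi> ^^ (q - 1)) ` {u. x \<in> window \<pi> q u}"
  then obtain u k where u: "y = (\<pi> ^^ (q - 1)) u" "k < q" "x = (\<pi> ^^ k) u"
    by (auto simp: window_def)
  then have "y = (\<pi> ^^ (q - 1 - k)) x"
    using funpow_add[of "q - 1 - k" k \<pi>] by (simp add: comp_def)
  then show "y \<in> window \<pi> q x"
    using \<open>k < q\<close> by (auto simp: window_def)
next
  fix y assume "y \<in> window \<pi> q x"
  then obtain j where j: "j < q" "y = (\<pi> ^^ j) x"
    by (auto simp: window_def)
  have "surj (\<pi> ^^ (q - 1 - j))"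
    using assms(1) by (simp add: bij_is_surj bij_betw_funpow)
  then obtain u where u: "x = (\<pi> ^^ (q - 1 - j)) u"
    by (metis surjD)
  have "y = (\<pi> ^^ (q - 1)) u"
    using funpow_add[of j "q - 1 - j" \<pi>] j u by (simp add: comp_def)
  moreover have "x \<in> window \<pi> q u"
    unfolding window_def u by (rule image_eqI[of _ _ "q - 1 - j"]) (use j in auto)
  ultimately show "y \<in> (\<pi> ^^ (q - 1)) ` {u. x \<in> window \<pi> q u}"
    by blast
qed

lemma card_window_starts:
  assumes "bij \<pi>" "q \<ge> 1"
  shows "card {u. x \<in> window \<pi> q u} = card (window \<pi> q x)"
proof -
  have "inj (\<pi> ^^ (q - 1))"
    using assms(1) by (simp add: bij_is_inj bij_betw_funpow)
  then show ?thesis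
    using card_image[OF inj_on_subset, of "\<pi> ^^ (q - 1)" UNIV "{u. x \<in> window \<pi> q u}"]
      funpow_image_window_starts[OF assms, of x] by simp
qed

lemma funpow_permutes_in_iff:
  assumes "\<pi> permutes L"
  shows "(\<pi> ^^ k) u \<in> L \<longleftrightarrow> u \<in> L"
  by (induction k) (simp_all add: permutes_in_image[OF assms])

lemma window_subset:
  assumes "\<pi> permutes L" "u \<in> L"
  shows "window \<pi> q u \<subseteq> L"
  using funpow_permutes_in_iff[OF assms(1)] assms(2)
  by (auto simp: window_def)

lemma sum_window_weights:
  assumes "\<pi> permutes L" "finite L" "q \<ge> 1" "x \<in> L"
  shows "(\<Sum>u\<in>L. 1 / real (card (window \<pi> q u)) * of_bool (x \<in> window \<pi> q u)) = 1"
proof -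
  let ?V = "{u. x \<in> window \<pi> q u}"
  have bij: "bij \<pi>"
    using assms(1) by (rule permutes_bij)
  have V: "?V \<subseteq> L"
    using funpow_permutes_in_iff[OF assms(1)] assms(4)
    by (auto simp: window_def)
  have "(\<Sum>u\<in>L. 1 / real (card (window \<pi> q u)) * of_bool (x \<in> window \<pi> q u)) =
      (\<Sum>u\<in>?V. 1 / real (card (window \<pi> q u)))"
    using V assms(2) by (intro sum.mono_neutral_cong_right) auto
  also have "\<dots> = (\<Sum>u\<in>?V. 1 / real (card (window \<pi> q x)))"
  proof (rule sum.cong)
    fix u assume "u \<in> ?V"
    then obtain k where "x = (\<pi> ^^ k) u"
      by (auto simp: window_def)
    then show "1 / real (card (window \<pi> q u)) = 1 / real (card (window \<pi> q x))"
      using card_window_funpow[OF bij_is_inj[OF bij]] by metis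
  qed simp
  also have "\<dots> = 1"
    using card_window_starts[OF bij assms(3), of x] window_self[OF assms(3), of x \<pi>] by auto
  finally show ?thesis .
qed

text \<open>A repetition among the \<open>q\<close> iterates would close the orbit within the
  window, and the orbit closes at \<open>x\<close>, the predecessor of the start.\<close>

lemma card_window_disjoint_pred:
  assumes "inj \<pi>" "x \<notin> window \<pi> q (\<pi> x)"
  shows "card (window \<pi> q (\<pi> x)) = q"
proof -
  have "inj_on (\<lambda>k. (\<pi> ^^ k) (\<pi> x)) {..<q}"
  proof (rule linorder_inj_onI)
    fix i j assume ij: "i < j" "j \<in> {..<q}"
    show "(\<pi> ^^ i) (\<pi> x) \<noteq> (\<pi> ^^ j) (\<pi> x)"
    proof
      assume "(\<pi> ^^ i) (\<pi> x) = (\<pi> ^^ j) (\<pi> x)"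
      also have "\<dots> = (\<pi> ^^ Suc i) ((\<pi> ^^ (j - Suc i)) (\<pi> x))"
        using funpow_add[of "Suc i" "j - Suc i" \<pi>] ij by (simp add: comp_def)
      finally have "(\<pi> ^^ Suc i) x = (\<pi> ^^ Suc i) ((\<pi> ^^ (j - Suc i)) (\<pi> x))"
        by (simp add: funpow_swap1)
      moreover have "inj (\<pi> ^^ Suc i)"
        using assms(1) by (rule inj_fn)
      ultimately have "x = (\<pi> ^^ (j - Suc i)) (\<pi> x)"
        by (meson injD)
      then have "x \<in> window \<pi> q (\<pi> x)"
        unfolding window_def by (rule image_eqI) (use ij in auto)
      with assms(2) show False ..
    qed
  qed auto
  then show ?thesis
    by (simp add: window_def card_image)
qed

text \<open>The windows through \<open>x\<close> already have total weight 1. The only other window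
  through \<open>\<pi> x\<close> is the one starting there; it has full length, hence weight
  \<open>1 / q\<close>. Only window boundaries thus cause double charging.\<close>

lemma sum_window_weights_pair:
  assumes "\<pi> permutes L" "finite L" "q \<ge> 1" "x \<in> L"
  defines "s \<equiv> \<Sum>u\<in>L. 1 / real (card (window \<pi> q u)) *
    of_bool (x \<in> window \<pi> q u \<or> \<pi> x \<in> window \<pi> q u)"
  shows "1 \<le> s" "s \<le> 1 + 1 / real q"
proof -
  let ?g = "\<lambda>u. 1 / real (card (window \<pi> q u))"
  have bij: "bij \<pi>"
    using assms(1) by (rule permutes_bij)
  have "(\<Sum>u\<in>L. ?g u * of_bool (x \<in> window \<pi> q u)) \<le> s"
    unfolding s_def by (intro sum_mono mult_left_mono) auto
  then show "1 \<le> s"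
    using sum_window_weights[OF assms(1-4)] by simp
  have extra: "u = \<pi> x \<and> ?g u = 1 / real q" if "\<pi> x \<in> window \<pi> q u" "x \<notin> window \<pi> q u" for u
  proof -
    from that obtain k where k: "k < q" "\<pi> x = (\<pi> ^^ k) u"
      by (auto simp: window_def)
    have "k = 0"
    proof (rule ccontr)
      assume "k \<noteq> 0"
      then obtain l where l: "k = Suc l"
        using not0_implies_Suc by blast
      then have "x = (\<pi> ^^ l) u"
        using k injD[OF bij_is_inj[OF bij]] by auto
      then have "x \<in> window \<pi> q u"
        unfolding window_def by (rule image_eqI) (use k l in auto)
      with that show False by simp
    qed
    then have "u = \<pi> x"
      using k by simp
    then show ?thesis
      using that card_window_disjoint_pred[OF bij_is_inj[OF bij], of x q] by simp
  qed
  have "s \<le> (\<Sum>u\<in>L. ?g u * of_bool (x \<in> window \<pi> q u) + of_bool (u = \<pi> x) * (1 / real q))"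
    unfolding s_def using extra by (intro sum_mono) (auto split: if_splits)
  also have "\<dots> = 1 + (\<Sum>u\<in>L. if u = \<pi> x then 1 / real q else 0)"
    unfolding sum.distrib sum_window_weights[OF assms(1-4)]
    by (intro arg_cong2[where f = "(+)"] sum.cong) auto
  also have "\<dots> \<le> 1 + 1 / real q"
    using assms(2) by (simp add: sum.delta)
  finally show "s \<le> 1 + 1 / real q" .
qed

section \<open>Local optima\<close>

text \<open>The complements of \<open>A\<close> and of its image have equal size, so any bijection
  between them completes the map.\<close>

lemma inj_on_extends_to_permutation:
  assumes "finite L" "A \<subseteq> L" "inj_on \<sigma> A" "\<sigma> ` A \<subseteq> L"
  obtains \<pi> where "\<pi> permutes L" "\<And>x. x \<in> A \<Longrightarrow> \<pi> x = \<sigma> x"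
proof -
  have fin: "finite (L - A)" "finite (L - \<sigma> ` A)"
    using assms(1) by auto
  have "card (L - A) = card (L - \<sigma> ` A)"
    using assms by (simp add: card_Diff_subset finite_subset[OF assms(2,1)] card_image)
  then obtain g where g: "bij_betw g (L - A) (L - \<sigma> ` A)"
    using finite_same_card_bij[OF fin] by blast
  define \<pi> where "\<pi> x = (if x \<in> A then \<sigma> x else if x \<in> L then g x else x)" for x
  have "bij_betw \<pi> A (\<sigma> ` A)"
    using assms(3) by (subst bij_betw_cong[of A \<pi> \<sigma>]) (auto simp: \<pi>_def bij_betw_def)
  moreover have "bij_betw \<pi> (L - A) (L - \<sigma> ` A)"
    using g by (subst bij_betw_cong[of "L - A" \<pi> g]) (auto simp: \<pi>_def)
  ultimately have "bij_betw \<pi> (A \<union> (L - A)) (\<sigma> ` A \<union> (L - \<sigma> ` A))"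
    by (rule bij_betw_combine) auto
  then have "bij_betw \<pi> L L"
    using assms(2,4) by (simp add: Un_Diff_cancel Un_absorb1)
  then have "\<pi> permutes L"
    by (rule bij_imp_permutes) (use assms(2) in \<open>auto simp: \<pi>_def\<close>)
  then show thesis
    using that \<pi>_def by auto
qed

lemma matching_unique:
  assumes "matching E M" "e \<in> M" "f \<in> M" "fst e = fst f \<or> snd e = snd f"
  shows "e = f"
  using assms unfolding matching_def by blast

lemma matching_subset: "matching E M \<Longrightarrow> N \<subseteq> M \<Longrightarrow> matching E N"
  unfolding matching_def by blast

text \<open>
  Identify \<open>R\<close> with \<open>L\<close> along the perfect matching: a second matching becomes a partial injection
  of \<open>L\<close>, whose orbits are the alternating paths and cycles. Completing it to a permutation
  spares the distinction between the two.
\<close>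

lemma matching_as_permutation:
  assumes "bipartite_graph L R E" "perfect_matching L R E N" "matching E M"
  obtains \<pi> f A where "\<pi> permutes L" "A \<subseteq> L" "inj_on f L"
    "N = (\<lambda>u. (u, f u)) ` L" "M = (\<lambda>u. (\<pi> u, f u)) ` A"
proof -
  have finL: "finite L" and EL: "E \<subseteq> L \<times> R"
    using assms(1) by (auto simp: bipartite_graph_def)
  have N: "matching E N" "fst ` N = L" "snd ` N = R"
    using assms(2) by (auto simp: perfect_matching_def)
  have "\<exists>v. (u, v) \<in> N" if "u \<in> L" for u
    using that N(2) by force
  then obtain f where f: "\<And>u. u \<in> L \<Longrightarrow> (u, f u) \<in> N"
    by metis
  have Nf: "N = (\<lambda>u. (u, f u)) ` L"
  proof (intro equalityI subsetI)
    fix e assume e: "e \<in> N"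
    then have "fst e \<in> L"
      using N(2) by blast
    then have "e = (fst e, f (fst e))"
      using matching_unique[OF N(1) e f] by simp
    then show "e \<in> (\<lambda>u. (u, f u)) ` L"
      using \<open>fst e \<in> L\<close> by blast
  qed (use f in auto)
  have injf: "inj_on f L"
  proof (rule inj_onI)
    fix x y assume "x \<in> L" "y \<in> L" "f x = f y"
    then show "x = y"
      using matching_unique[OF N(1) f f, of x y] by simp
  qed
  have fL: "f ` L = R"
    using N(3) Nf by (simp add: image_image)
  define A where "A = {u \<in> L. \<exists>x. (x, f u) \<in> M}"
  have AL: "A \<subseteq> L"
    by (auto simp: A_def)
  \<comment> \<open>One alternating step: from \<open>u\<close> along \<open>N\<close> to
    \<open>f u\<close>, then back to the left side along \<open>M\<close>. The set \<open>A\<close>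
    consists of the vertices where the second edge exists.\<close>
  define \<sigma> where "\<sigma> u = (SOME x. (x, f u) \<in> M)" for u
  have \<sigma>: "(\<sigma> u, f u) \<in> M" if "u \<in> A" for u
    using that someI_ex[of "\<lambda>x. (x, f u) \<in> M"] by (auto simp: A_def \<sigma>_def)
  have M: "M \<subseteq> L \<times> R"
    using assms(3) EL by (auto simp: matching_def)
  have "inj_on \<sigma> A"
  proof (rule inj_onI)
    fix x y assume xy: "x \<in> A" "y \<in> A" "\<sigma> x = \<sigma> y"
    then have "f x = f y"
      using matching_unique[OF assms(3) \<sigma> \<sigma>, of x y] by simp
    then show "x = y"
      using xy injf by (auto simp: A_def inj_on_def)
  qed
  moreover have "\<sigma> ` A \<subseteq> L"
    using \<sigma> M by auto
  ultimately obtain \<pi> where \<pi>: "\<pi> permutes L" "\<And>x. x \<in> A \<Longrightarrow> \<pi> x = \<sigma> x"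
    using inj_on_extends_to_permutation[OF finL, of A \<sigma>] AL by blast
  have "M = (\<lambda>u. (\<pi> u, f u)) ` A"
  proof (intro equalityI subsetI)
    fix e assume e: "e \<in> M"
    then obtain u where u: "u \<in> L" "snd e = f u"
      using M fL by force
    then have "u \<in> A"
      using e unfolding A_def by (cases e) auto
    moreover have "e = (\<pi> u, f u)"
      using matching_unique[OF assms(3) e \<sigma>[OF \<open>u \<in> A\<close>]] u \<pi>(2)[OF \<open>u \<in> A\<close>] by simp
    ultimately show "e \<in> (\<lambda>u. (\<pi> u, f u)) ` A"
      by blast
  qed (use \<sigma> \<pi>(2) in auto)
  then show thesis
    using that[OF \<pi>(1) AL injf Nf] by blast
qed

text \<open>
  In the potential \<open>2 ^ T * card M - overload T S M\<close>, an edge of \<open>S i\<close> costs about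
  \<open>2 * (card (M \<inter> S i) - 2 ^ i) / 2 ^ i\<close> times what it earns: nothing as long as \<open>S i\<close>
  respects its bound, and more than it earns once the bound is exceeded twofold.
\<close>

definition overload :: "nat \<Rightarrow> (nat \<Rightarrow> 'e set) \<Rightarrow> 'e set \<Rightarrow> nat" where
  "overload T S M = (\<Sum>i\<in>{1..T}. 2 ^ (T - i) * (card (M \<inter> S i) - 2 ^ i)\<^sup>2)"

text \<open>The potential may be negative, so each overload is moved to the other side of the
  inequality to avoid truncated subtraction.\<close>

definition local_opt ::
  "nat \<Rightarrow> ('v \<times> 'v) set \<Rightarrow> nat \<Rightarrow> (nat \<Rightarrow> ('v \<times> 'v) set) \<Rightarrow> ('v \<times> 'v) set \<Rightarrow> bool" where
  "local_opt K E T S M \<longleftrightarrow> matching E M \<and>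
     (\<forall>M'. matching E M' \<and> card (sym_diff M M') \<le> K \<longrightarrow>
        2 ^ T * card M' + overload T S M \<le> 2 ^ T * card M + overload T S M')"

text \<open>Deleting one edge of a set loaded beyond twice its capacity forfeits
  \<open>2 ^ T\<close>. If \<open>a\<close> is the excess that remains, then
  \<open>a \<ge> 2 ^ i\<close> and the squared excess drops by \<open>2 * a + 1\<close>, which after
  weighting is worth more than \<open>2 ^ T\<close>. The terms of the other sets cannot
  grow.\<close>

lemma local_opt_card_le:
  assumes "finite E" "local_opt K E T S M" "K \<ge> 1" "i \<in> {1..T}"
  shows "card (M \<inter> S i) \<le> 2 * 2 ^ i"
proof (rule ccontr)
  let ?a = "\<lambda>M i. card (M \<inter> S i) - 2 ^ i"
  assume big: "\<not> ?thesis"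
  have M: "matching E M"
    using assms(2) by (simp add: local_opt_def)
  then have fin: "finite M"
    using assms(1) finite_subset by (auto simp: matching_def)
  from big have "M \<inter> S i \<noteq> {}"
    by auto
  then obtain e where e: "e \<in> M" "e \<in> S i"
    by auto
  let ?M = "M - {e}"
  have "sym_diff M ?M = {e}"
    using e by auto
  then have opt: "2 ^ T * card ?M + overload T S M \<le> 2 ^ T * card M + overload T S ?M"
    using assms(2,3) matching_subset[OF M, of ?M] by (auto simp: local_opt_def)
  have "card M = Suc (card ?M)"
    using card_Suc_Diff1[OF fin e(1)] by simp
  with opt have *: "overload T S M \<le> 2 ^ T + overload T S ?M"
    by (simp only: mult_Suc_right)
  define D :: nat where "D = 2 ^ i"
  have "card (?M \<inter> S i) = card (M \<inter> S i) - 1"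
    using fin e by (simp add: Diff_Int_distrib2 card_Diff_singleton)
  then have ai: "?a M i = Suc (?a ?M i)" "?a ?M i \<ge> D"
    using big by (auto simp: D_def)
  have "(?a M i)\<^sup>2 = (?a ?M i)\<^sup>2 + 2 * ?a ?M i + 1"
    unfolding ai(1) by (simp add: power2_eq_square)
  then have "2 ^ (T - i) * (?a M i)\<^sup>2 = 2 ^ (T - i) * (?a ?M i)\<^sup>2 + 2 ^ (T - i) * (2 * ?a ?M i + 1)"
    by (simp add: algebra_simps)
  moreover have "2 ^ (T - i) * (2 * ?a ?M i + 1) > 2 ^ (T - i) * D"
    using ai(2) by (intro mult_strict_left_mono) auto
  moreover have "2 ^ (T - i) * D = 2 ^ T"
    using assms(4) unfolding D_def by (simp flip: power_add)
  ultimately have "2 ^ (T - i) * (?a M i)\<^sup>2 > 2 ^ T + 2 ^ (T - i) * (?a ?M i)\<^sup>2"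
    by linarith
  moreover have "2 ^ (T - j) * (?a ?M j)\<^sup>2 \<le> 2 ^ (T - j) * (?a M j)\<^sup>2" for j
    using fin by (intro mult_left_mono power_mono diff_le_mono card_mono) auto
  then have "(\<Sum>j\<in>{1..T} - {i}. 2 ^ (T - j) * (?a ?M j)\<^sup>2) \<le> (\<Sum>j\<in>{1..T} - {i}. 2 ^ (T - j) * (?a M j)\<^sup>2)"
    by (intro sum_mono)
  ultimately have "overload T S M > 2 ^ T + overload T S ?M"
    unfolding overload_def sum.remove[OF finite_atLeastAtMost assms(4)] by linarith
  with * show False by simp
qed

lemma overload_valid: "valid 1 T S M \<Longrightarrow> overload T S M = 0"
proof -
  assume valid: "valid 1 T S M"
  have "card (M \<inter> S i) \<le> 2 ^ i" if "i \<in> {1..T}" for i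
    using valid that of_nat_le_iff[where ?'a = real, of "card (M \<inter> S i)" "2 ^ i"]
    by (simp add: valid_def)
  then show ?thesis
    by (simp add: overload_def)
qed

text \<open>With \<open>K\<close> as large as the edge set, \<open>N\<close> itself is one move
  away, and its overload is 0.\<close>

lemma global_opt_card_ge:
  assumes "finite E" "local_opt K E T S M" "card E \<le> K" "matching E N" "valid 1 T S N"
  shows "card N \<le> card M"
proof -
  have "sym_diff M N \<subseteq> E"
    using assms(2,4) by (auto simp: local_opt_def matching_def)
  then have "card (sym_diff M N) \<le> K"
    using card_mono[OF assms(1)] assms(3) order_trans by blast
  then have "2 ^ T * card N + overload T S M \<le> 2 ^ T * card M + overload T S N"
    using assms(2,4) by (simp add: local_opt_def)
  then have "2 ^ T * card N \<le> 2 ^ T * card M"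
    using overload_valid[OF assms(5)] by linarith
  then show ?thesis
    by simp
qed

section \<open>The exchange argument: averaging weighted switches\<close>

lemma sum_weighted_card:
  fixes g :: "'a \<Rightarrow> real"
  assumes "finite B"
  shows "(\<Sum>u\<in>L. g u * real (card {x \<in> B. P u x \<and> Q x})) =
    (\<Sum>x\<in>{x \<in> B. Q x}. \<Sum>u\<in>L. g u * of_bool (P u x))"
proof -
  have "real (card {x \<in> B. P u x \<and> Q x}) = (\<Sum>x\<in>{x \<in> B. Q x}. of_bool (P u x))" for u
  proof -
    have "{x \<in> B. P u x \<and> Q x} = {x \<in> {x \<in> B. Q x}. P u x}"
      by auto
    then show ?thesis
      using assms by (simp add: sum.If_cases of_bool_def Int_def)
  qed
  then have "(\<Sum>u\<in>L. g u * real (card {x \<in> B. P u x \<and> Q x})) =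
    (\<Sum>u\<in>L. \<Sum>x\<in>{x \<in> B. Q x}. g u * of_bool (P u x))"
    by (simp only: sum_distrib_left)
  also have "\<dots> = (\<Sum>x\<in>{x \<in> B. Q x}. \<Sum>u\<in>L. g u * of_bool (P u x))"
    by (rule sum.swap)
  finally show ?thesis .
qed

text \<open>The second-order upper bound for the function \<open>(max 0 y)\<^sup>2\<close>, whose
  derivative is \<open>2 * max 0 y\<close>: clipping at 0 only helps for \<open>y \<ge> 0\<close>,
  and for negative \<open>y\<close> the positive part of \<open>y + d\<close> is at most
  \<open>\<bar>d\<bar>\<close>.\<close>

lemma pos_part_square_add_le:
  fixes y d :: real
  shows "(max 0 (y + d))\<^sup>2 \<le> (max 0 y)\<^sup>2 + 2 * max 0 y * d + d\<^sup>2"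
proof (cases "y \<ge> 0")
  case True
  have "(max 0 (y + d))\<^sup>2 \<le> (y + d)\<^sup>2"
    by (simp add: max_def)
  then show ?thesis
    using True by (simp add: power2_sum)
next
  case False
  then have "(max 0 (y + d))\<^sup>2 \<le> \<bar>d\<bar>\<^sup>2"
    by (intro power_mono) auto
  then show ?thesis
    using False by simp
qed

lemma real_overload:
  "real (overload T S M) =
    (\<Sum>i\<in>{1..T}. 2 ^ (T - i) * (max 0 (real (card (M \<inter> S i)) - 2 ^ i))\<^sup>2)"
proof -
  have "real (a - 2 ^ i) = max 0 (real a - 2 ^ i)" for a i :: nat
    by (cases "2 ^ i \<le> a") (auto simp: of_nat_diff not_le)
  then show ?thesis
    by (simp add: overload_def)
qed

context
  fixes L R A :: "'v set" and E N M :: "('v \<times> 'v) set" and \<pi> f :: "'v \<Rightarrow> 'v" and q :: nat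
  assumes graph: "bipartite_graph L R E"
    and N: "perfect_matching L R E N" "N = (\<lambda>u. (u, f u)) ` L"
    and M: "matching E M" "M = (\<lambda>u. (\<pi> u, f u)) ` A"
    and \<pi>: "\<pi> permutes L" and A: "A \<subseteq> L" and f: "inj_on f L" and q: "q \<ge> 1"
begin

text \<open>The \<open>M\<close>-edge \<open>(\<pi> x, f x)\<close> meets the \<open>N\<close>-edge
  at \<open>x\<close> on the right and the \<open>N\<close>-edge at \<open>\<pi> x\<close> on the
  left. Hence these are exactly the \<open>M\<close>-edges that touch an \<open>N\<close>-edge of
  the window.\<close>

definition removed :: "'v \<Rightarrow> 'v set" where
  "removed u = {x \<in> A. x \<in> window \<pi> q u \<or> \<pi> x \<in> window \<pi> q u}"

definition switch :: "'v \<Rightarrow> ('v \<times> 'v) set" where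
  "switch u = (M - (\<lambda>x. (\<pi> x, f x)) ` removed u) \<union> (\<lambda>x. (x, f x)) ` window \<pi> q u"

lemma finite_L: "finite L" and finite_A: "finite A" and finite_M: "finite M"
  using graph A M(2) finite_subset by (auto simp: bipartite_graph_def)

lemma inj_on_M: "inj_on (\<lambda>x. (\<pi> x, f x)) A" and inj_on_N: "inj_on (\<lambda>x. (x, f x)) L"
  using f A by (auto simp: inj_on_def)

lemma finite_removed: "finite (removed u)"
  using finite_A by (simp add: removed_def)

lemma card_removed_le: "card (removed u) \<le> 2 * q"
proof -
  have "removed u \<subseteq> window \<pi> q u \<union> \<pi> -` window \<pi> q u"
    by (auto simp: removed_def)
  moreover have "finite (\<pi> -` window \<pi> q u)" "card (\<pi> -` window \<pi> q u) \<le> card (window \<pi> q u)"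
    using permutes_inj[OF \<pi>] card_vimage_inj_on_le[of \<pi> UNIV "window \<pi> q u"]
    by (auto intro: finite_vimageI)
  ultimately have "card (removed u) \<le> card (window \<pi> q u) + card (window \<pi> q u)"
    by (meson add_left_mono card_Un_le card_mono finite_Un finite_window order_trans)
  then show ?thesis
    using card_window_le[of \<pi> q u] by linarith
qed

text \<open>A surviving \<open>M\<close>-edge \<open>(\<pi> x, f x)\<close> has both
  \<open>x\<close> and \<open>\<pi> x\<close> outside the window; as \<open>f\<close> is injective,
  neither of its endpoints is covered by an added edge.\<close>

lemma matching_switch:
  assumes u: "u \<in> L"
  shows "matching E (switch u)"
proof -
  let ?W = "window \<pi> q u"
  have W: "?W \<subseteq> L"
    using window_subset[OF \<pi> u] .
  have NM: "matching E N"
    using N(1) by (simp add: perfect_matching_def)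
  have "(\<lambda>x. (x, f x)) ` ?W \<subseteq> N"
    using N(2) W by auto
  have mixed: "fst e \<noteq> fst e' \<and> snd e \<noteq> snd e'"
    if e: "e \<in> M - (\<lambda>x. (\<pi> x, f x)) ` removed u" and e': "e' \<in> (\<lambda>x. (x, f x)) ` ?W" for e e'
  proof -
    obtain x where x: "x \<in> A" "e = (\<pi> x, f x)" "x \<notin> ?W" "\<pi> x \<notin> ?W"
      using e M(2) by (auto simp: removed_def)
    obtain y where y: "y \<in> ?W" "e' = (y, f y)"
      using e' by auto
    have "f x \<noteq> f y"
      using inj_onD[OF f, of x y] x y A W by auto
    then show ?thesis
      using x y by auto
  qed
  have "matching E (M - (\<lambda>x. (\<pi> x, f x)) ` removed u)"
    using M(1) by (rule matching_subset) blast
  moreover have "matching E ((\<lambda>x. (x, f x)) ` ?W)"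
    using NM by (rule matching_subset) fact
  ultimately show ?thesis
    using mixed unfolding matching_def switch_def by (smt (verit) UnE Un_subset_iff)
qed

text \<open>At most \<open>q\<close> edges are added, and each window vertex accounts for at most
  two removals, one per side. This is the origin of the move size \<open>3 * q\<close>.\<close>

lemma card_sym_diff_switch: "card (sym_diff M (switch u)) \<le> 3 * q"
proof -
  let ?D = "(\<lambda>x. (\<pi> x, f x)) ` removed u \<union> (\<lambda>x. (x, f x)) ` window \<pi> q u"
  have "card (sym_diff M (switch u)) \<le> card ?D"
    using finite_removed by (intro card_mono) (auto simp: switch_def)
  also have "\<dots> \<le> card (removed u) + card (window \<pi> q u)"
    using finite_removed
    by (intro order_trans[OF card_Un_le] add_mono card_image_le) auto
  finally show ?thesis
    using card_removed_le[of u] card_window_le[of \<pi> q u] by linarith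
qed

text \<open>An edge of both matchings inside the window is removed and then added back; it is
  counted once with each sign, so the difference of the two counts stays exact.\<close>

lemma card_switch:
  assumes u: "u \<in> L"
  shows "real (card (switch u \<inter> Z)) = real (card (M \<inter> Z)) +
    (real (card {x \<in> window \<pi> q u. (x, f x) \<in> Z}) - real (card {x \<in> removed u. (\<pi> x, f x) \<in> Z}))"
proof -
  let ?rem = "(\<lambda>x. (\<pi> x, f x)) ` {x \<in> removed u. (\<pi> x, f x) \<in> Z}"
  let ?add = "(\<lambda>x. (x, f x)) ` {x \<in> window \<pi> q u. (x, f x) \<in> Z}"
  have W: "window \<pi> q u \<subseteq> L"
    using window_subset[OF \<pi> u] .
  have rem: "?rem \<subseteq> M \<inter> Z"
    using M(2) by (auto simp: removed_def)
  have "switch u \<inter> Z = ((M \<inter> Z) - ?rem) \<union> ?add"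
    by (auto simp: switch_def)
  moreover have "((M \<inter> Z) - ?rem) \<inter> ?add = {}"
    using M(2) by (auto simp: removed_def)
  ultimately have "card (switch u \<inter> Z) = card ((M \<inter> Z) - ?rem) + card ?add"
    using finite_M by (simp add: card_Un_disjoint)
  moreover have "card ?rem = card {x \<in> removed u. (\<pi> x, f x) \<in> Z}"
    by (intro card_image inj_on_subset[OF inj_on_M]) (auto simp: removed_def)
  moreover have "card ?add = card {x \<in> window \<pi> q u. (x, f x) \<in> Z}"
    by (intro card_image inj_on_subset[OF inj_on_N]) (use W in auto)
  moreover have "card ((M \<inter> Z) - ?rem) = card (M \<inter> Z) - card ?rem" "card ?rem \<le> card (M \<inter> Z)"
    using rem finite_M by (auto intro!: card_Diff_subset card_mono intro: finite_subset)
  ultimately show ?thesis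
    by (simp add: of_nat_diff)
qed

lemma sum_added:
  "(\<Sum>u\<in>L. 1 / real (card (window \<pi> q u)) * real (card {x \<in> window \<pi> q u. (x, f x) \<in> Z})) =
    real (card (N \<inter> Z))"
proof -
  have "{x \<in> window \<pi> q u. (x, f x) \<in> Z} = {x \<in> L. x \<in> window \<pi> q u \<and> (x, f x) \<in> Z}" if "u \<in> L" for u
    using window_subset[OF \<pi> that, of q] by auto
  then have "(\<Sum>u\<in>L. 1 / real (card (window \<pi> q u)) * real (card {x \<in> window \<pi> q u. (x, f x) \<in> Z})) =
    (\<Sum>u\<in>L. 1 / real (card (window \<pi> q u)) * real (card {x \<in> L. x \<in> window \<pi> q u \<and> (x, f x) \<in> Z}))"
    by simp
  also have "\<dots> = (\<Sum>x\<in>{x \<in> L. (x, f x) \<in> Z}. 1)"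
    unfolding sum_weighted_card[OF finite_L]
    by (intro sum.cong refl sum_window_weights[OF \<pi> finite_L q]) auto
  also have "\<dots> = real (card ((\<lambda>x. (x, f x)) ` {x \<in> L. (x, f x) \<in> Z}))"
    by (subst card_image) (auto intro: inj_on_subset[OF inj_on_N])
  also have "(\<lambda>x. (x, f x)) ` {x \<in> L. (x, f x) \<in> Z} = N \<inter> Z"
    using N(2) by auto
  finally show ?thesis .
qed

text \<open>The lower bound makes the first-order change of the penalty nonpositive; the upper bound
  limits the loss of edges and the size of the second-order terms.\<close>

lemma sum_removed:
  defines "s \<equiv> \<lambda>Z. \<Sum>u\<in>L. 1 / real (card (window \<pi> q u)) * real (card {x \<in> removed u. (\<pi> x, f x) \<in> Z})"
  shows "real (card (M \<inter> Z)) \<le> s Z" "s Z \<le> (1 + 1 / real q) * real (card (M \<inter> Z))"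
proof -
  let ?B = "{x \<in> A. (\<pi> x, f x) \<in> Z}"
  have "{x \<in> removed u. (\<pi> x, f x) \<in> Z} =
      {x \<in> A. (x \<in> window \<pi> q u \<or> \<pi> x \<in> window \<pi> q u) \<and> (\<pi> x, f x) \<in> Z}" for u
    by (auto simp: removed_def)
  then have s: "s Z = (\<Sum>x\<in>?B. \<Sum>u\<in>L. 1 / real (card (window \<pi> q u)) *
      of_bool (x \<in> window \<pi> q u \<or> \<pi> x \<in> window \<pi> q u))"
    unfolding s_def by (simp only: sum_weighted_card[OF finite_A])
  have "card ?B = card ((\<lambda>x. (\<pi> x, f x)) ` ?B)"
    by (subst card_image) (auto intro: inj_on_subset[OF inj_on_M])
  also have "(\<lambda>x. (\<pi> x, f x)) ` ?B = M \<inter> Z"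
    using M(2) by auto
  finally have B: "card ?B = card (M \<inter> Z)" .
  have bounds: "1 \<le> (\<Sum>u\<in>L. 1 / real (card (window \<pi> q u)) * of_bool (x \<in> window \<pi> q u \<or> \<pi> x \<in> window \<pi> q u))"
    "(\<Sum>u\<in>L. 1 / real (card (window \<pi> q u)) * of_bool (x \<in> window \<pi> q u \<or> \<pi> x \<in> window \<pi> q u)) \<le> 1 + 1 / real q"
    if "x \<in> ?B" for x
    using sum_window_weights_pair[OF \<pi> finite_L q, of x] that A by auto
  show "real (card (M \<inter> Z)) \<le> s Z"
    using sum_mono[of ?B "\<lambda>_. 1::real", OF bounds(1)] unfolding s B[symmetric] by simp
  show "s Z \<le> (1 + 1 / real q) * real (card (M \<inter> Z))"
    using sum_mono[of ?B _ "\<lambda>_. 1 + 1 / real q", OF bounds(2)] unfolding s B[symmetric]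
    by (simp add: mult.commute)
qed

text \<open>
  Summed over all \<open>u\<close> with weight \<open>1 / card (window \<pi> q u)\<close>, the switches add every edge of \<open>N\<close>
  once and remove every edge of \<open>M\<close> at least once and at most \<open>1 + 1 / q\<close> times. By convexity
  the first-order change of the overload is at most 0, so only the second-order terms remain.
\<close>

lemma local_opt_card_ge_aux:
  assumes opt: "local_opt K E T S M" "3 * q \<le> K"
    and bound: "\<And>i. i \<in> {1..T} \<Longrightarrow> card (M \<inter> S i) \<le> 2 * 2 ^ i"
    and valid: "valid 1 T S N"
  shows "real (card L) \<le> (1 + 1 / real q) * real (card M) + 15 * real q * real T"
proof -
  define g where "g u = 1 / real (card (window \<pi> q u))" for u
  define add where "add u Z = real (card {x \<in> window \<pi> q u. (x, f x) \<in> Z})" for u Z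
  define rem where "rem u Z = real (card {x \<in> removed u. (\<pi> x, f x) \<in> Z})" for u Z
  define x where "x i = max 0 (real (card (M \<inter> S i)) - 2 ^ i)" for i
  define d where "d u i = add u (S i) - rem u (S i)" for u i
  have g0: "g u \<ge> 0" for u
    by (simp add: g_def)
  have nonneg: "add u Z \<ge> 0" "rem u Z \<ge> 0" for u Z
    by (simp_all add: add_def rem_def)
  have small: "add u Z + rem u Z \<le> 3 * real q" for u Z
  proof -
    have "card {x \<in> window \<pi> q u. (x, f x) \<in> Z} \<le> card (window \<pi> q u)"
      "card {x \<in> removed u. (\<pi> x, f x) \<in> Z} \<le> card (removed u)"
      using finite_removed by (auto intro: card_mono)
    then show ?thesis
      using card_removed_le[of u] card_window_le[of \<pi> q u] by (simp add: add_def rem_def)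
  qed
  have sw: "real (card (switch u \<inter> Z)) = real (card (M \<inter> Z)) + (add u Z - rem u Z)" if "u \<in> L" for u Z
    using card_switch[OF that] by (simp add: add_def rem_def)
  have sum_add: "(\<Sum>u\<in>L. g u * add u Z) = real (card (N \<inter> Z))" for Z
    using sum_added by (simp add: g_def add_def)
  have sum_rem: "real (card (M \<inter> Z)) \<le> (\<Sum>u\<in>L. g u * rem u Z)"
    "(\<Sum>u\<in>L. g u * rem u Z) \<le> (1 + 1 / real q) * real (card (M \<inter> Z))" for Z
    using sum_removed[of Z] by (simp_all add: g_def rem_def)
  \<comment> \<open>Local optimality against the single switch at \<open>u\<close>, with the
    increase of the overload bounded by its first- and second-order terms.\<close>
  have step: "2 ^ T * (add u UNIV - rem u UNIV) \<le>
      (\<Sum>i\<in>{1..T}. 2 ^ (T - i) * (2 * x i * d u i + (d u i)\<^sup>2))" if u: "u \<in> L" for u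
  proof -
    have "2 ^ T * card (switch u) + overload T S M \<le> 2 ^ T * card M + overload T S (switch u)"
      using opt matching_switch[OF u] card_sym_diff_switch[of u] by (auto simp: local_opt_def)
    then have "real (2 ^ T * card (switch u) + overload T S M) \<le> real (2 ^ T * card M + overload T S (switch u))"
      by (rule of_nat_mono)
    then have "2 ^ T * (real (card (switch u)) - real (card M)) \<le>
        real (overload T S (switch u)) - real (overload T S M)"
      by (simp add: algebra_simps)
    also have "\<dots> = (\<Sum>i\<in>{1..T}. 2 ^ (T - i) * ((max 0 ((real (card (M \<inter> S i)) - 2 ^ i) + d u i))\<^sup>2 - (x i)\<^sup>2))"
      unfolding real_overload sum_subtractf[symmetric] sw[OF u] d_def x_def
      by (intro sum.cong) (simp_all add: algebra_simps)
    also have "\<dots> \<le> (\<Sum>i\<in>{1..T}. 2 ^ (T - i) * (2 * x i * d u i + (d u i)\<^sup>2))"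
    proof (intro sum_mono mult_left_mono)
      fix i
      show "(max 0 ((real (card (M \<inter> S i)) - 2 ^ i) + d u i))\<^sup>2 - (x i)\<^sup>2 \<le> 2 * x i * d u i + (d u i)\<^sup>2"
        using pos_part_square_add_le[of "real (card (M \<inter> S i)) - 2 ^ i" "d u i"] by (simp add: x_def)
    qed simp
    finally show ?thesis
      using sw[OF u, of UNIV] by simp
  qed
  \<comment> \<open>The constant is \<open>3 * (1 + 4)\<close>: a switch makes at most
    \<open>3 * q\<close> changes, additions to \<open>S i\<close> have total weight at most
    \<open>2 ^ i\<close>, and removals at most \<open>2 * (2 * 2 ^ i)\<close>, since
    \<open>1 + 1 / q \<le> 2\<close> and the load is at most \<open>2 * 2 ^ i\<close>.\<close>
  have second: "2 ^ (T - i) * (\<Sum>u\<in>L. g u * (2 * x i * d u i + (d u i)\<^sup>2)) \<le> 15 * real q * 2 ^ T"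
    if i: "i \<in> {1..T}" for i
  proof -
    have Ni: "real (card (N \<inter> S i)) \<le> 2 ^ i"
      using valid i by (simp add: valid_def)
    have Mi: "real (card (M \<inter> S i)) \<le> 2 * 2 ^ i"
      using of_nat_mono[OF bound[OF i], where ?'a = real] by simp
    have "(\<Sum>u\<in>L. g u * d u i) = real (card (N \<inter> S i)) - (\<Sum>u\<in>L. g u * rem u (S i))"
      by (simp add: d_def right_diff_distrib sum_subtractf sum_add)
    also have "\<dots> \<le> 2 ^ i - real (card (M \<inter> S i))"
      using Ni sum_rem(1)[of "S i"] by linarith
    finally have "x i * (\<Sum>u\<in>L. g u * d u i) \<le> x i * (2 ^ i - real (card (M \<inter> S i)))"
      by (rule mult_left_mono) (simp add: x_def)
    \<comment> \<open>If \<open>x i\<close> is positive, it is the negative of the second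
      factor.\<close>
    also have "\<dots> \<le> 0"
      by (auto simp: x_def max_def mult_nonneg_nonpos)
    finally have first: "x i * (\<Sum>u\<in>L. g u * d u i) \<le> 0" .
    \<comment> \<open>Only one factor of the square is replaced by the uniform bound; the other
      stays linear, so that its weighted sum is again governed by the loads.\<close>
    have dsq: "(d u i)\<^sup>2 \<le> 3 * real q * (add u (S i) + rem u (S i))" for u
    proof -
      have "\<bar>d u i\<bar> \<le> add u (S i) + rem u (S i)"
        using nonneg[of u "S i"] by (simp add: d_def)
      then have "\<bar>d u i\<bar> * \<bar>d u i\<bar> \<le> (3 * real q) * (add u (S i) + rem u (S i))"
        using small[of u "S i"] by (intro mult_mono) auto
      then show ?thesis
        by (simp add: power2_eq_square)
    qed
    have "(\<Sum>u\<in>L. g u * (d u i)\<^sup>2) \<le> (\<Sum>u\<in>L. g u * (3 * real q * (add u (S i) + rem u (S i))))"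
      by (intro sum_mono mult_left_mono dsq g0)
    also have "\<dots> = 3 * real q * ((\<Sum>u\<in>L. g u * add u (S i)) + (\<Sum>u\<in>L. g u * rem u (S i)))"
      by (simp add: sum_distrib_left flip: sum.distrib) (simp add: algebra_simps)
    also have "\<dots> \<le> 3 * real q * (2 ^ i + 2 * (2 * 2 ^ i))"
    proof (intro mult_left_mono add_mono)
      show "(\<Sum>u\<in>L. g u * add u (S i)) \<le> 2 ^ i"
        using Ni sum_add by simp
      have "(\<Sum>u\<in>L. g u * rem u (S i)) \<le> (1 + 1 / real q) * real (card (M \<inter> S i))"
        by (rule sum_rem)
      also have "\<dots> \<le> 2 * (2 * 2 ^ i)"
        using Mi q by (intro mult_mono) (auto simp: field_simps)
      finally show "(\<Sum>u\<in>L. g u * rem u (S i)) \<le> 2 * (2 * 2 ^ i)" .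
    qed simp
    finally have sq: "(\<Sum>u\<in>L. g u * (d u i)\<^sup>2) \<le> 15 * real q * 2 ^ i"
      by simp
    have "(\<Sum>u\<in>L. g u * (2 * x i * d u i + (d u i)\<^sup>2)) =
        2 * (x i * (\<Sum>u\<in>L. g u * d u i)) + (\<Sum>u\<in>L. g u * (d u i)\<^sup>2)"
      by (simp add: sum_distrib_left flip: sum.distrib) (simp add: algebra_simps)
    also have "\<dots> \<le> 15 * real q * 2 ^ i"
      using first sq by linarith
    finally have "2 ^ (T - i) * (\<Sum>u\<in>L. g u * (2 * x i * d u i + (d u i)\<^sup>2)) \<le> 2 ^ (T - i) * (15 * real q * 2 ^ i)"
      by (rule mult_left_mono) simp
    also have "\<dots> = 15 * real q * 2 ^ (T - i + i)"
      by (simp only: power_add ac_simps)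
    finally show ?thesis
      using i by simp
  qed
  \<comment> \<open>Taking \<open>Z = UNIV\<close> counts whole matchings; the inequalities
    \<open>step\<close> are now added up with the window weights.\<close>
  have "2 ^ T * (real (card N) - (1 + 1 / real q) * real (card M)) \<le>
      2 ^ T * ((\<Sum>u\<in>L. g u * add u UNIV) - (\<Sum>u\<in>L. g u * rem u UNIV))"
    using sum_rem(2)[of UNIV] by (intro mult_left_mono) (auto simp: sum_add)
  also have "\<dots> = (\<Sum>u\<in>L. g u * (2 ^ T * (add u UNIV - rem u UNIV)))"
    by (simp add: sum_distrib_left flip: sum_subtractf) (simp add: algebra_simps)
  also have "\<dots> \<le> (\<Sum>u\<in>L. g u * (\<Sum>i\<in>{1..T}. 2 ^ (T - i) * (2 * x i * d u i + (d u i)\<^sup>2)))"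
    by (intro sum_mono mult_left_mono step g0)
  also have "\<dots> = (\<Sum>u\<in>L. \<Sum>i\<in>{1..T}. 2 ^ (T - i) * (g u * (2 * x i * d u i + (d u i)\<^sup>2)))"
    by (simp only: sum_distrib_left mult.left_commute)
  also have "\<dots> = (\<Sum>i\<in>{1..T}. 2 ^ (T - i) * (\<Sum>u\<in>L. g u * (2 * x i * d u i + (d u i)\<^sup>2)))"
    by (subst sum.swap) (simp only: sum_distrib_left)
  also have "\<dots> \<le> (\<Sum>i\<in>{1..T}. 15 * real q * 2 ^ T)"
    by (intro sum_mono second)
  also have "\<dots> = 2 ^ T * (15 * real q * real T)"
    by simp
  finally have "real (card N) - (1 + 1 / real q) * real (card M) \<le> 15 * real q * real T"
    by simp
  moreover have "card N = card L"
    using N(2) inj_on_N by (simp add: card_image)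
  ultimately show ?thesis
    by simp
qed

end

lemma local_opt_card_ge:
  assumes "bipartite_graph L R E" "perfect_matching L R E N" "valid 1 T S N"
    and "local_opt K E T S M" "q \<ge> 1" "3 * q \<le> K"
  shows "real (card L) \<le> (1 + 1 / real q) * real (card M) + 15 * real q * real T"
proof -
  have M: "matching E M"
    using assms(4) by (simp add: local_opt_def)
  have finE: "finite E"
    using assms(1) finite_subset by (auto simp: bipartite_graph_def)
  obtain \<pi> f A where *: "\<pi> permutes L" "A \<subseteq> L" "inj_on f L"
    "N = (\<lambda>u. (u, f u)) ` L" "M = (\<lambda>u. (\<pi> u, f u)) ` A"
    by (rule matching_as_permutation[OF assms(1,2) M])
  show ?thesis
  proof (rule local_opt_card_ge_aux[OF assms(1,2) *(4) M *(5) *(1-3) assms(5) assms(4,6) _ assms(3)])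
    show "card (M \<inter> S i) \<le> 2 * 2 ^ i" if "i \<in> {1..T}" for i
      using local_opt_card_le[OF finE assms(4) _ that] assms(5,6) by linarith
  qed
qed

section \<open>Time-bounded reachability on the word RAM\<close>

definition reaches :: "nat \<Rightarrow> prog \<Rightarrow> state \<Rightarrow> nat \<Rightarrow> (state \<Rightarrow> bool) \<Rightarrow> bool" where
  "reaches w P s t Q \<longleftrightarrow> (\<exists>t' s'. exec w P s t' s' \<and> t' \<le> t \<and> Q s')"

lemma reaches_mono:
  assumes "reaches w P s t Q" "t \<le> t'" "\<And>s'. Q s' \<Longrightarrow> Q' s'"
  shows "reaches w P s t' Q'"
  using assms order_trans unfolding reaches_def by blast

lemma reaches_Assign:
  assumes "Q (rg(r := expr_val w (rg, mem) e), mem)"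
  shows "reaches w (Assign r e) (rg, mem) (expr_time e + 1) Q"
  unfolding reaches_def using assms exec_Assign[of w r e "(rg, mem)"] by auto

lemma reaches_AssignI:
  assumes "Q (rg(r := expr_val w (rg, mem) e), mem)" "expr_time e + 1 \<le> t"
  shows "reaches w (Assign r e) (rg, mem) t Q"
  using assms reaches_Assign reaches_mono by blast

lemma reaches_StoreI:
  assumes "Q (rg, mem(expr_val w (rg, mem) a := expr_val w (rg, mem) e))"
    and "expr_time a + expr_time e + 1 \<le> t"
  shows "reaches w (Store a e) (rg, mem) t Q"
  unfolding reaches_def using assms exec_Store[of w a e "(rg, mem)"] by auto

lemma reaches_Seq:
  assumes "reaches w P s t1 (\<lambda>s'. reaches w P' s' t2 Q)" "t1 + t2 \<le> t"
  shows "reaches w (Seq P P') s t Q"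
proof -
  obtain u1 s1 where 1: "exec w P s u1 s1" "u1 \<le> t1" "reaches w P' s1 t2 Q"
    using assms(1) unfolding reaches_def[of w P s] by blast
  then obtain u2 s2 where "exec w P' s1 u2 s2" "u2 \<le> t2" "Q s2"
    by (auto simp: reaches_def)
  then show ?thesis
    using exec_Seq[OF 1(1)] 1(2) assms(2) unfolding reaches_def
    by (meson add_mono order_trans)
qed

lemmas reaches_Seq' = reaches_Seq[OF _ order_refl]

lemma reaches_time:
  assumes "reaches w P s t Q" "t \<le> t'"
  shows "reaches w P s t' Q"
  using assms by (rule reaches_mono)

lemma reaches_Cond:
  assumes "expr_val w s b \<noteq> 0 \<Longrightarrow> reaches w P s t Q" "expr_val w s b = 0 \<Longrightarrow> reaches w P' s t Q"
    and "expr_time b + 1 + t \<le> t'"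
  shows "reaches w (Cond b P P') s t' Q"
proof (cases "expr_val w s b = 0")
  case True
  then obtain u s' where "exec w P' s u s'" "u \<le> t" "Q s'"
    using assms(2) by (auto simp: reaches_def)
  then show ?thesis
    using exec_Cond_false[OF True, of P' u s' P] assms(3) unfolding reaches_def
    by (meson add_left_mono order_trans)
next
  case False
  then obtain u s' where "exec w P s u s'" "u \<le> t" "Q s'"
    using assms(1) by (auto simp: reaches_def)
  then show ?thesis
    using exec_Cond_true[OF False, of P u s' P'] assms(3) unfolding reaches_def
    by (meson add_left_mono order_trans)
qed

text \<open>The measure \<open>\<mu>\<close> does double duty: its decrease gives termination, and
  its initial value bounds the number of iterations, each costing the body and one test.\<close>

lemma reaches_While:
  assumes "I s"
    and step: "\<And>s. I s \<Longrightarrow> expr_val w s b \<noteq> 0 \<Longrightarrow> reaches w P s t (\<lambda>s'. I s' \<and> \<mu> s' < \<mu> s)"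
    and post: "\<And>s'. I s' \<Longrightarrow> expr_val w s' b = 0 \<Longrightarrow> Q s'"
    and time: "\<mu> s * (t + expr_time b + 1) + expr_time b + 1 \<le> t'"
  shows "reaches w (While b P) s t' Q"
proof -
  have "reaches w (While b P) s (\<mu> s * (t + expr_time b + 1) + expr_time b + 1) Q"
    using assms(1)
  proof (induction "\<mu> s" arbitrary: s rule: less_induct)
    case less
    show ?case
    proof (cases "expr_val w s b = 0")
      case True
      then show ?thesis
        using exec_While_false[OF True, of P] post[OF less.prems True] unfolding reaches_def
        by (intro exI[of _ "expr_time b + 1"] exI[of _ s]) simp
    next
      case False
      obtain u1 s1 where 1: "exec w P s u1 s1" "u1 \<le> t" "I s1" "\<mu> s1 < \<mu> s"
        using step[OF less.prems False] by (auto simp: reaches_def)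
      obtain u2 s2 where 2: "exec w (While b P) s1 u2 s2" "Q s2"
        "u2 \<le> \<mu> s1 * (t + expr_time b + 1) + expr_time b + 1"
        using less.hyps[OF 1(4,3)] by (auto simp: reaches_def)
      have "Suc (\<mu> s1) * (t + expr_time b + 1) \<le> \<mu> s * (t + expr_time b + 1)"
        using 1(4) by (intro mult_le_mono1) simp
      then have "expr_time b + 1 + u1 + u2 \<le> \<mu> s * (t + expr_time b + 1) + expr_time b + 1"
        using 1(2) 2(3) by simp
      then show ?thesis
        using exec_While_true[OF False 1(1) 2(1)] 2(2) unfolding reaches_def by blast
    qed
  qed
  then show ?thesis
    using time by (rule reaches_mono)
qed

definition for_loop :: "nat \<Rightarrow> nat \<Rightarrow> prog \<Rightarrow> prog" where
  "for_loop r b P = Seq (Assign r (Lit 0))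
     (While (Op Less (Reg r) (Reg b)) (Seq P (Assign r (Op Add (Reg r) (Lit 1)))))"

text \<open>The invariant after the body is stated for the registers with the counter already
  advanced, so bodies are verified without the increment. Per round, increment and test cost 4 each;
  initialisation and the last test give the 6. The bound on \<open>N\<close> keeps the counter from
  wrapping around.\<close>

lemma reaches_for_loop:
  assumes N: "rg b = N" "N < 2 ^ w" and w: "1 < (2::nat) ^ w" and rb: "r \<noteq> b"
    and init: "I 0 (rg(r := 0)) mem"
    and step: "\<And>j rg mem. j < N \<Longrightarrow> I j rg mem \<Longrightarrow> rg r = j \<Longrightarrow> rg b = N \<Longrightarrow>
      reaches w P (rg, mem) t (\<lambda>(rg', mem'). rg' r = j \<and> rg' b = N \<and> I (Suc j) (rg'(r := Suc j)) mem')"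
    and post: "\<And>rg mem. I N rg mem \<Longrightarrow> rg r = N \<Longrightarrow> rg b = N \<Longrightarrow> Q (rg, mem)"
    and time: "N * (t + 8) + 6 \<le> t'"
  shows "reaches w (for_loop r b P) (rg, mem) t' Q"
proof -
  define J where "J = (\<lambda>(rg :: nat \<Rightarrow> nat, mem :: nat \<Rightarrow> nat).
    \<exists>j\<le>N. I j rg mem \<and> rg r = j \<and> rg b = N)"
  let ?b = "Op Less (Reg r) (Reg b)"
  have "reaches w (While ?b (Seq P (Assign r (Op Add (Reg r) (Lit 1))))) (rg(r := 0), mem) (N * (t + 8) + 4) Q"
  proof (rule reaches_While[where I = J and \<mu> = "\<lambda>s. N - fst s r" and t = "t + 4"])
    show "J (rg(r := 0), mem)"
      using init N rb by (auto simp: J_def)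
    show "Q s'" if "J s'" "expr_val w s' ?b = 0" for s'
      using that w post by (auto simp: J_def split: if_splits)
    fix s assume s: "J s" "expr_val w s ?b \<noteq> 0"
    then obtain rg' mem' j where s': "s = (rg', mem')" "I j rg' mem'" "rg' r = j" "rg' b = N" "j < N"
      by (auto simp: J_def split: if_splits)
    show "reaches w (Seq P (Assign r (Op Add (Reg r) (Lit 1)))) s (t + 4)
        (\<lambda>s'. J s' \<and> N - fst s' r < N - fst s r)"
      unfolding s'(1)
    proof (rule reaches_Seq[where ?t2.0 = 4])
      show "reaches w P (rg', mem') t (\<lambda>s'. reaches w (Assign r (Op Add (Reg r) (Lit 1))) s' 4
        (\<lambda>s'. J s' \<and> N - fst s' r < N - fst (rg', mem') r))"
      proof (rule reaches_mono[OF step[OF s'(5,2,3,4)] order_refl])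
        fix s1 assume "case s1 of (rg'', mem'') \<Rightarrow>
          rg'' r = j \<and> rg'' b = N \<and> I (Suc j) (rg''(r := Suc j)) mem''"
        then obtain rg'' mem'' where s1: "s1 = (rg'', mem'')" "rg'' r = j" "rg'' b = N"
          "I (Suc j) (rg''(r := Suc j)) mem''"
          by auto
        have "J (rg''(r := expr_val w s1 (Op Add (Reg r) (Lit 1))), mem'')"
          using s1 s' rb N(2) w by (auto simp: J_def intro!: exI[of _ "Suc j"])
        moreover have "N - expr_val w s1 (Op Add (Reg r) (Lit 1)) < N - rg' r"
          using s1 s' N(2) w by auto
        ultimately show "reaches w (Assign r (Op Add (Reg r) (Lit 1))) s1 4
            (\<lambda>s'. J s' \<and> N - fst s' r < N - fst (rg', mem') r)"
          unfolding s1(1) by (intro reaches_AssignI) auto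
      qed
    qed simp
  qed (use rb in auto)
  then have "reaches w (for_loop r b P) (rg, mem) (N * (t + 8) + 6) Q"
    unfolding for_loop_def
    by (intro reaches_Seq[OF reaches_Assign, where ?t2.0 = "N * (t + 8) + 4"]) auto
  then show ?thesis
    using time by (rule reaches_mono)
qed

definition eq_expr :: "expr \<Rightarrow> expr \<Rightarrow> expr" where
  "eq_expr a b = Op Sub (Lit 1) (Op Add (Op Less a b) (Op Less b a))"

lemma expr_val_eq_expr [simp]:
  assumes "1 < (2::nat) ^ w"
  shows "expr_val w s (eq_expr a b) = of_bool (expr_val w s a = expr_val w s b)"
  using assms by (auto simp: eq_expr_def)

lemma expr_time_eq_expr [simp]:
  "expr_time (eq_expr a b) = 2 * (expr_time a + expr_time b) + 5"
  by (simp add: eq_expr_def)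

definition copy_prog :: "nat \<Rightarrow> nat \<Rightarrow> prog" where
  "copy_prog src dst = for_loop 16 0
     (Store (Op Add (Reg dst) (Reg 16)) (Mem (Op Add (Reg src) (Reg 16))))"

lemma reaches_copy:
  assumes "rg src + n \<le> 2 ^ w" "rg dst + n \<le> 2 ^ w" "n < 2 ^ w" "1 < (2::nat) ^ w" "rg 0 = n"
    and "rg src + n \<le> rg dst \<or> rg dst + n \<le> rg src" "src \<noteq> 16" "dst \<noteq> 16"
    and Q: "Q (rg(16 := n), \<lambda>a. if rg dst \<le> a \<and> a < rg dst + n then mem (rg src + (a - rg dst)) else mem a)"
    and "16 * n + 6 \<le> t"
  shows "reaches w (copy_prog src dst) (rg, mem) t Q"
  unfolding copy_prog_def
proof (rule reaches_for_loop[where N = n and t = 8 and I = "\<lambda>j rg' mem'. rg' = rg(16 := j) \<and>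
      mem' = (\<lambda>a. if rg dst \<le> a \<and> a < rg dst + j then mem (rg src + (a - rg dst)) else mem a)"])
  fix j rg' mem'
  assume j: "j < n" and I: "rg' = rg(16 := j) \<and>
      mem' = (\<lambda>a. if rg dst \<le> a \<and> a < rg dst + j then mem (rg src + (a - rg dst)) else mem a)"
    and "rg' 16 = j" "rg' 0 = n"
  have read: "mem' (rg src + j) = mem (rg src + j)"
    using I assms(6) j by auto
  show "reaches w (Store (Op Add (Reg dst) (Reg 16)) (Mem (Op Add (Reg src) (Reg 16)))) (rg', mem') 8
      (\<lambda>(rg'', mem''). rg'' 16 = j \<and> rg'' 0 = n \<and> rg''(16 := Suc j) = rg(16 := Suc j) \<and>
        mem'' = (\<lambda>a. if rg dst \<le> a \<and> a < rg dst + Suc j then mem (rg src + (a - rg dst)) else mem a))"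
    by (rule reaches_StoreI) (use I j assms read in \<open>auto simp: fun_eq_iff\<close>)
next
  show "Q (rg', mem')" if "rg' = rg(16 := n) \<and> mem' =
      (\<lambda>a. if rg dst \<le> a \<and> a < rg dst + n then mem (rg src + (a - rg dst)) else mem a)" for rg' mem'
    using that Q by simp
qed (use assms in \<open>auto simp: fun_eq_iff\<close>)

text \<open>The parameter \<open>f\<close> selects a component of the input triple of an edge: 0 for
  the left endpoint, 1 for the right endpoint, 2 for the set number. The key is in register 10, and
  multiplying by the selection bit replaces a branch.\<close>

definition count_prog :: "nat \<Rightarrow> prog" where
  "count_prog f = Seq (Assign 11 (Lit 0)) (for_loop 16 0
     (Assign 11 (Op Add (Reg 11) (Op Mul (Mem (Op Add (Reg 8) (Reg 16)))
        (eq_expr (Mem (Op Add (Op Mul (Lit 3) (Reg 16)) (Lit (2 + f)))) (Reg 10))))))"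

lemma reaches_count:
  assumes "rg 0 = n" "rg 8 + n < 2 ^ w" "3 * n + 5 < 2 ^ w" "f < 3"
    and Y: "\<And>j. j < n \<Longrightarrow> mem (rg 8 + j) = of_bool (j \<in> Y)"
    and Q: "Q (rg(11 := card {j \<in> Y. j < n \<and> mem (3 * j + 2 + f) = rg 10}, 16 := n), mem)"
    and "35 * n + 8 \<le> t"
  shows "reaches w (count_prog f) (rg, mem) t Q"
  unfolding count_prog_def
proof (rule reaches_Seq[OF reaches_Assign], rule reaches_for_loop[where N = n and t = 27 and
    I = "\<lambda>i rg' mem'. rg' = rg(11 := card {j \<in> Y. j < i \<and> mem (3 * j + 2 + f) = rg 10}, 16 := i) \<and> mem' = mem"])
  let ?c = "\<lambda>i. card {j \<in> Y. j < i \<and> mem (3 * j + 2 + f) = rg 10}"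
  fix i rg' mem'
  assume i: "i < n" and I: "rg' = rg(11 := ?c i, 16 := i) \<and> mem' = mem"
  have c: "?c (Suc i) = ?c i + of_bool (i \<in> Y) * of_bool (mem (3 * i + 2 + f) = rg 10)"
  proof -
    have "{j \<in> Y. j < Suc i \<and> mem (3 * j + 2 + f) = rg 10} =
      {j \<in> Y. j < i \<and> mem (3 * j + 2 + f) = rg 10} \<union>
      (if i \<in> Y \<and> mem (3 * i + 2 + f) = rg 10 then {i} else {})"
      by (auto simp: less_Suc_eq)
    then show ?thesis
      by (auto simp: card_insert_if)
  qed
  have le: "?c i \<le> i"
    using card_mono[of "{..<i}" "{j \<in> Y. j < i \<and> mem (3 * j + 2 + f) = rg 10}"] by auto
  have w: "1 < (2::nat) ^ w" "?c i + 1 < 2 ^ w" "i < 2 ^ w" "3 * i < 2 ^ w" "3 * i + (2 + f) < 2 ^ w"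
     "rg 8 + i < 2 ^ w" "2 + f < 2 ^ w" "3 < (2::nat) ^ w"
    using assms(2-4) i le by linarith+
  have val: "expr_val w (rg', mem') (Op Add (Reg 11) (Op Mul (Mem (Op Add (Reg 8) (Reg 16)))
        (eq_expr (Mem (Op Add (Op Mul (Lit 3) (Reg 16)) (Lit (2 + f)))) (Reg 10)))) = ?c (Suc i)"
    unfolding c using I i w Y[OF i] by (auto simp: add.assoc)
  show "reaches w (Assign 11 (Op Add (Reg 11) (Op Mul (Mem (Op Add (Reg 8) (Reg 16)))
        (eq_expr (Mem (Op Add (Op Mul (Lit 3) (Reg 16)) (Lit (2 + f)))) (Reg 10))))) (rg', mem') 27
      (\<lambda>(rg'', mem''). rg'' 16 = i \<and> rg'' 0 = n \<and>
         rg''(16 := Suc i) = rg(11 := ?c (Suc i), 16 := Suc i) \<and> mem'' = mem)"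
  proof (rule reaches_AssignI)
    show "case (rg'(11 := expr_val w (rg', mem') (Op Add (Reg 11) (Op Mul (Mem (Op Add (Reg 8) (Reg 16)))
        (eq_expr (Mem (Op Add (Op Mul (Lit 3) (Reg 16)) (Lit (2 + f)))) (Reg 10))))), mem') of
      (rg'', mem'') \<Rightarrow> rg'' 16 = i \<and> rg'' 0 = n \<and>
         rg''(16 := Suc i) = rg(11 := ?c (Suc i), 16 := Suc i) \<and> mem'' = mem"
      unfolding val using I assms(1) by (auto simp: fun_eq_iff)
  qed auto
next
  show "Q (rg', mem')" if "rg' = rg(11 := card {j \<in> Y. j < n \<and> mem (3 * j + 2 + f) = rg 10}, 16 := n) \<and>
    mem' = mem" for rg' mem'
    using that Q by simp
qed (use assms in \<open>auto simp: fun_eq_iff\<close>)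

section \<open>The search program\<close>

text \<open>
  Registers: 0 to 4 hold \<open>n\<close>, \<open>T\<close>, \<open>W = 2 ^ T\<close>, \<open>K\<close> and \<open>B = (n + 1) ^ K\<close>; 5 is the number of
  the current move, 6 the score of the current solution, 7 and 8 the addresses of the current
  solution and of the candidate; 18 is never written and stays 0. In memory, the input occupies
  the cells below \<open>3 * n + 2\<close>; the current solution follows, then one junk cell, then the
  candidate from \<open>4 * n + 3\<close> on.

  Each excess edge at a vertex is charged \<open>W * n\<close>, the largest possible gain, so that a
  non-matching has score 0 by truncation and never beats the current solution.
\<close>

definition vertex_loop :: prog where
  "vertex_loop = for_loop 15 0
     (Seq (Assign 10 (Reg 15))
     (Seq (count_prog 0)
     (Seq (Assign 13 (Op Add (Reg 13) (Reg 11)))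
     (Seq (Assign 12 (Op Add (Reg 12) (Op Mul (Op Mul (Reg 2) (Reg 0)) (Op Sub (Reg 11) (Lit 1)))))
     (Seq (count_prog 1)
       (Assign 12 (Op Add (Reg 12) (Op Mul (Op Mul (Reg 2) (Reg 0)) (Op Sub (Reg 11) (Lit 1))))))))))"

text \<open>Register 14 runs through the capacities by doubling, and dividing
  \<open>W = 2 ^ T\<close> by it yields the weight \<open>2 ^ (T - i)\<close>. The loop counter
  starts at 0 while sets are numbered from 1, hence the key is one more than the counter.\<close>

definition set_loop :: prog where
  "set_loop = for_loop 15 1
     (Seq (Assign 10 (Op Add (Reg 15) (Lit 1)))
     (Seq (Assign 14 (Op Add (Reg 14) (Reg 14)))
     (Seq (count_prog 2)
       (Assign 12 (Op Add (Reg 12) (Op Mul (Op Div (Reg 2) (Reg 14))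
         (Op Mul (Op Sub (Reg 11) (Reg 14)) (Op Sub (Reg 11) (Reg 14)))))))))"

definition eval_prog :: prog where
  "eval_prog =
     Seq (Assign 12 (Lit 0)) (Seq (Assign 13 (Lit 0)) (Seq vertex_loop (Seq (Assign 14 (Lit 1)) set_loop)))"

definition toggle_prog :: prog where
  "toggle_prog = Seq (Assign 9 (Reg 5)) (for_loop 16 3
     (Seq (Store (Op Add (Op Sub (Reg 8) (Lit 1)) (Op Mod (Reg 9) (Op Add (Reg 0) (Lit 1))))
         (Op Sub (Lit 1) (Mem (Op Add (Op Sub (Reg 8) (Lit 1)) (Op Mod (Reg 9) (Op Add (Reg 0) (Lit 1)))))))
       (Assign 9 (Op Div (Reg 9) (Op Add (Reg 0) (Lit 1))))))"

text \<open>
  The digits of a move are one more than the edges to be toggled; the digit 0 toggles the junk cell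
  and thus pads moves with fewer than \<open>K\<close> edges.
\<close>

primrec flips :: "nat \<Rightarrow> nat \<Rightarrow> nat \<Rightarrow> nat set" where
  "flips b c 0 = {}"
| "flips b c (Suc k) = sym_diff (flips b c k) {(c div b ^ k) mod b}"

text \<open>These bounds keep the modular arithmetic exact. Addresses stay below
  \<open>5 * n + 10\<close>. Conflicts contribute at most \<open>2 * n\<close> times
  \<open>W * n * n\<close>, and the at most \<open>n\<close> sets contribute
  \<open>W * n * n\<close> each, which fits into \<open>W_bound\<close>; its summand
  \<open>2 * W\<close> leaves room for the doubled powers.\<close>

locale machine =
  fixes w n T W K B :: nat and inp :: "nat \<Rightarrow> nat"
  assumes n_bound: "5 * n + 10 < 2 ^ w"
    and W_bound: "4 * n * (W * n * n) + 2 * W < 2 ^ w"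
    and T_le: "T \<le> n" and W: "W = 2 ^ T"
    and K_bound: "K < 2 ^ w" and B: "B = (n + 1) ^ K" and B_bound: "B < 2 ^ w"
begin

lemma w_gt: "10 < (2::nat) ^ w"
  using n_bound by linarith

lemma w_pos: "0 < w"
  using w_gt by (cases w) auto

text \<open>For \<open>f = 0\<close> and \<open>f = 1\<close> this will be the degree of a left or
  right vertex in the selected subgraph, for \<open>f = 2\<close> the load of the set numbered
  \<open>v\<close>.\<close>

definition deg :: "nat \<Rightarrow> nat set \<Rightarrow> nat \<Rightarrow> nat" where
  "deg f Y v = card {j \<in> Y. j < n \<and> inp (3 * j + 2 + f) = v}"

definition size_upto :: "nat set \<Rightarrow> nat \<Rightarrow> nat" where
  "size_upto Y v = (\<Sum>u<v. deg 0 Y u)"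

definition conflicts_upto :: "nat set \<Rightarrow> nat \<Rightarrow> nat" where
  "conflicts_upto Y v = (\<Sum>u<v. W * n * (deg 0 Y u - 1) + W * n * (deg 1 Y u - 1))"

definition penalty_upto :: "nat set \<Rightarrow> nat \<Rightarrow> nat" where
  "penalty_upto Y i =
     conflicts_upto Y n + (\<Sum>k<i. W div 2 ^ Suc k * (deg 2 Y (Suc k) - 2 ^ Suc k)\<^sup>2)"

definition score :: "nat set \<Rightarrow> nat" where
  "score Y = W * size_upto Y n - penalty_upto Y T"

lemma size_upto_Suc: "size_upto Y (Suc v) = size_upto Y v + deg 0 Y v"
  by (simp add: size_upto_def)

lemma conflicts_upto_Suc:
  "conflicts_upto Y (Suc v) = conflicts_upto Y v + W * n * (deg 0 Y v - 1) + W * n * (deg 1 Y v - 1)"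
  by (simp add: conflicts_upto_def)

lemma penalty_upto_Suc:
  "penalty_upto Y (Suc i) = penalty_upto Y i + W div 2 ^ Suc i * (deg 2 Y (Suc i) - 2 ^ Suc i)\<^sup>2"
  by (simp add: penalty_upto_def)

lemma deg_le: "deg f Y v \<le> n"
  using card_mono[of "{..<n}" "{j \<in> Y. j < n \<and> inp (3 * j + 2 + f) = v}"]
  by (auto simp: deg_def)

lemma deg_mult_le: "c * (deg f Y v - d) \<le> c * n"
  using deg_le[of f Y v] by (intro mult_le_mono2) linarith

lemma conflicts_upto_le: "conflicts_upto Y v \<le> v * (2 * (W * n * n))"
proof -
  have "conflicts_upto Y v \<le> (\<Sum>u<v. 2 * (W * n * n))"
    unfolding conflicts_upto_def
  proof (rule sum_mono)
    fix u
    show "W * n * (deg 0 Y u - 1) + W * n * (deg 1 Y u - 1) \<le> 2 * (W * n * n)"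
      using deg_mult_le[of "W * n" 0 Y u 1] deg_mult_le[of "W * n" 1 Y u 1] by linarith
  qed
  then show ?thesis
    by simp
qed

lemma term_le: "W div p * (deg 2 Y v - d)\<^sup>2 \<le> W * n * n"
proof -
  have "(deg 2 Y v - d)\<^sup>2 \<le> n * n"
    unfolding power2_eq_square using deg_le[of 2 Y v] by (intro mult_le_mono) linarith+
  then have "W div p * (deg 2 Y v - d)\<^sup>2 \<le> W * (n * n)"
    by (intro mult_le_mono) auto
  then show ?thesis
    by (simp add: mult.assoc)
qed

lemma penalty_upto_le: "penalty_upto Y i \<le> n * (2 * (W * n * n)) + i * (W * n * n)"
proof -
  have "(\<Sum>k<i. W div 2 ^ Suc k * (deg 2 Y (Suc k) - 2 ^ Suc k)\<^sup>2) \<le> (\<Sum>k<i. W * n * n)"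
    by (rule sum_mono) (rule term_le)
  then show ?thesis
    using conflicts_upto_le[of Y n] by (simp add: penalty_upto_def)
qed

lemma size_upto_le: "size_upto Y v \<le> card (Y \<inter> {..<n})"
proof -
  have "size_upto Y v = card (\<Union>u<v. {j \<in> Y. j < n \<and> inp (3 * j + 2) = u})"
    unfolding size_upto_def deg_def by (subst card_UN_disjoint) auto
  also have "\<dots> \<le> card (Y \<inter> {..<n})"
    by (rule card_mono) auto
  finally show ?thesis .
qed

lemma size_upto_le_n: "size_upto Y v \<le> n"
  using size_upto_le[of Y v] card_mono[of "{..<n}" "Y \<inter> {..<n}"] by simp

lemma reaches_count_deg:
  assumes Q: "Q (rg(11 := deg f Y (rg 10), 16 := n), mem)"
    and rg: "rg 0 = n" "rg 8 = 4 * n + 3" and "f < 3"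
    and mem: "\<And>a. a < 3 * n + 2 \<Longrightarrow> mem a = inp a" "\<And>j. j < n \<Longrightarrow> mem (4 * n + 3 + j) = of_bool (j \<in> Y)"
  shows "reaches w (count_prog f) (rg, mem) (35 * n + 8) Q"
proof (rule reaches_count[where Y = Y])
  have "deg f Y (rg 10) = card {j \<in> Y. j < n \<and> mem (3 * j + 2 + f) = rg 10}"
    unfolding deg_def using mem(1) \<open>f < 3\<close> by (intro arg_cong[where f = card]) auto
  then show "Q (rg(11 := card {j \<in> Y. j < n \<and> mem (3 * j + 2 + f) = rg 10}, 16 := n), mem)"
    using Q by simp
qed (use assms n_bound in auto)

lemma reaches_vertex_loop:
  assumes rg: "rg 0 = n" "rg 2 = W" "rg 8 = 4 * n + 3" "rg 12 = 0" "rg 13 = 0"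
    and mem: "\<And>a. a < 3 * n + 2 \<Longrightarrow> mem a = inp a" "\<And>j. j < n \<Longrightarrow> mem (4 * n + 3 + j) = of_bool (j \<in> Y)"
    and Q: "\<And>rg'. (\<And>r. r \<notin> {10..16} \<Longrightarrow> rg' r = rg r) \<Longrightarrow> rg' 12 = conflicts_upto Y n \<Longrightarrow>
      rg' 13 = size_upto Y n \<Longrightarrow> Q (rg', mem)"
  shows "reaches w vertex_loop (rg, mem) (n * (70 * n + 50) + 6) Q"
  unfolding vertex_loop_def
proof (rule reaches_for_loop[where N = n and t = "70 * n + 42" and I = "\<lambda>v rg' mem'. mem' = mem \<and>
    (\<forall>r. r \<notin> {10..16} \<longrightarrow> rg' r = rg r) \<and> rg' 12 = conflicts_upto Y v \<and> rg' 13 = size_upto Y v"])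
  fix v rg' mem'
  let ?add = "Assign 12 (Op Add (Reg 12) (Op Mul (Op Mul (Reg 2) (Reg 0)) (Op Sub (Reg 11) (Lit 1))))"
  assume v: "v < n" and I: "mem' = mem \<and> (\<forall>r. r \<notin> {10..16} \<longrightarrow> rg' r = rg r) \<and>
      rg' 12 = conflicts_upto Y v \<and> rg' 13 = size_upto Y v" and "rg' 15 = v" "rg' 0 = n"
  then have rg': "rg' 2 = W" "rg' 8 = 4 * n + 3"
    using rg by auto
  \<comment> \<open>Since \<open>v < n\<close>, the accumulated charges leave room for both charges
    of the current vertex.\<close>
  have "v * (2 * (W * n * n)) \<le> (n - 1) * (2 * (W * n * n))"
    using v by (intro mult_le_mono1) linarith
  also have "\<dots> + 2 * (W * n * n) = n * (2 * (W * n * n))"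
    using v by (cases n) auto
  finally have "v * (2 * (W * n * n)) + 2 * (W * n * n) \<le> 4 * n * (W * n * n)"
    by simp
  then have bounds: "conflicts_upto Y v + W * n * n + W * n * n < 2 ^ w"
    using conflicts_upto_le[of Y v] W_bound by linarith
  have "W * n \<le> W * n * n"
    using v by simp
  then have small: "W * n < 2 ^ w" "W * n * (deg 0 Y v - 1) < 2 ^ w" "W * n * (deg 1 Y v - 1) < 2 ^ w"
      "conflicts_upto Y v + W * n * (deg 0 Y v - 1) < 2 ^ w"
      "conflicts_upto Y v + W * n * (deg 0 Y v - 1) + W * n * (deg 1 Y v - 1) < 2 ^ w"
    using bounds deg_mult_le[of "W * n" 0 Y v 1] deg_mult_le[of "W * n" 1 Y v 1] by linarith+
  have small': "size_upto Y v + deg 0 Y v < 2 ^ w" "1 < (2::nat) ^ w" "deg 0 Y v < 2 ^ w"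
      "deg 1 Y v < 2 ^ w" "deg 0 Y v - 1 < 2 ^ w" "deg 1 Y v - 1 < 2 ^ w"
    using size_upto_le_n[of Y v] deg_le[of 0 Y v] deg_le[of 1 Y v] n_bound by linarith+
  show "reaches w (Seq (Assign 10 (Reg 15)) (Seq (count_prog 0) (Seq (Assign 13 (Op Add (Reg 13) (Reg 11)))
      (Seq ?add (Seq (count_prog 1) ?add))))) (rg', mem') (70 * n + 42)
      (\<lambda>(rg'', mem''). rg'' 15 = v \<and> rg'' 0 = n \<and> mem'' = mem \<and>
        (\<forall>r. r \<notin> {10..16} \<longrightarrow> (rg''(15 := Suc v)) r = rg r) \<and>
        (rg''(15 := Suc v)) 12 = conflicts_upto Y (Suc v) \<and> (rg''(15 := Suc v)) 13 = size_upto Y (Suc v))"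
    by (rule reaches_time, rule reaches_Seq', rule reaches_Assign, rule reaches_Seq',
        rule reaches_count_deg[where Y = Y], rule reaches_Seq', rule reaches_Assign,
        rule reaches_Seq', rule reaches_Assign, rule reaches_Seq',
        rule reaches_count_deg[where Y = Y], rule reaches_Assign)
      (use I rg' \<open>rg' 15 = v\<close> \<open>rg' 0 = n\<close> mem small small' w_pos in
        \<open>simp_all add: conflicts_upto_Suc size_upto_Suc add.assoc\<close>)
next
  show "Q (rg', mem')" if "mem' = mem \<and> (\<forall>r. r \<notin> {10..16} \<longrightarrow> rg' r = rg r) \<and>
      rg' 12 = conflicts_upto Y n \<and> rg' 13 = size_upto Y n" for rg' mem'
    using that Q by blast
qed (use rg n_bound in \<open>auto simp: conflicts_upto_def size_upto_def\<close>)

lemma reaches_set_loop: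
  assumes rg: "rg 0 = n" "rg 1 = T" "rg 2 = W" "rg 8 = 4 * n + 3" "rg 12 = penalty_upto Y 0" "rg 14 = 1"
    and mem: "\<And>a. a < 3 * n + 2 \<Longrightarrow> mem a = inp a" "\<And>j. j < n \<Longrightarrow> mem (4 * n + 3 + j) = of_bool (j \<in> Y)"
    and Q: "\<And>rg'. (\<And>r. r \<notin> {10..16} \<Longrightarrow> rg' r = rg r) \<Longrightarrow> rg' 12 = penalty_upto Y T \<Longrightarrow>
      rg' 13 = rg 13 \<Longrightarrow> Q (rg', mem)"
  shows "reaches w set_loop (rg, mem) (n * (35 * n + 38) + 6) Q"
  unfolding set_loop_def
proof (rule reaches_for_loop[where N = T and t = "35 * n + 30" and I = "\<lambda>i rg' mem'. mem' = mem \<and>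
    (\<forall>r. r \<notin> {10..16} \<longrightarrow> rg' r = rg r) \<and> rg' 12 = penalty_upto Y i \<and> rg' 13 = rg 13 \<and> rg' 14 = 2 ^ i"])
  fix i rg' mem'
  assume i: "i < T" and I: "mem' = mem \<and> (\<forall>r. r \<notin> {10..16} \<longrightarrow> rg' r = rg r) \<and>
      rg' 12 = penalty_upto Y i \<and> rg' 13 = rg 13 \<and> rg' 14 = 2 ^ i" and "rg' 15 = i" "rg' 1 = T"
  then have rg': "rg' 0 = n" "rg' 2 = W" "rg' 8 = 4 * n + 3"
    using rg by auto
  define p :: nat where "p = 2 ^ Suc i"
  define d where "d = deg 2 Y (Suc i) - p"
  have "(2::nat) ^ Suc i \<le> 2 ^ T"
    using i by (intro power_increasing) auto
  then have p: "p < 2 ^ w" "2 ^ i + 2 ^ i = p"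
    using W W_bound by (auto simp: p_def)
  have "n \<ge> 1"
    using i T_le by simp
  have d: "d \<le> n"
    using deg_le[of 2 Y "Suc i"] by (simp add: d_def)
  have "W div p * (d * d) \<le> W * n * n"
    using term_le[of p Y "Suc i" p] by (simp add: d_def power2_eq_square)
  moreover have "penalty_upto Y i + W * n * n \<le> 4 * n * (W * n * n)"
  proof -
    have "Suc i * (W * n * n) \<le> n * (W * n * n)"
      using i T_le by (intro mult_le_mono1) simp
    then show ?thesis
      using penalty_upto_le[of Y i] by simp
  qed
  moreover have "d * d \<le> W * n * n"
  proof -
    have "d * d \<le> 1 * (n * n)"
      using d by (simp add: mult_le_mono)
    also have "\<dots> \<le> W * (n * n)"
      using W by (intro mult_le_mono1) simp
    finally show ?thesis
      by (simp add: mult.assoc)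
  qed
  ultimately have small: "penalty_upto Y i + W div p * (d * d) < 2 ^ w" "W div p * (d * d) < 2 ^ w" "d * d < 2 ^ w"
    using W_bound by linarith+
  have "W div p \<le> W"
    by simp
  then have small': "d < 2 ^ w" "1 < (2::nat) ^ w" "Suc i < 2 ^ w" "W div p < 2 ^ w"
    using i T_le d n_bound W_bound by linarith+
  show "reaches w (Seq (Assign 10 (Op Add (Reg 15) (Lit 1))) (Seq (Assign 14 (Op Add (Reg 14) (Reg 14)))
      (Seq (count_prog 2) (Assign 12 (Op Add (Reg 12) (Op Mul (Op Div (Reg 2) (Reg 14))
         (Op Mul (Op Sub (Reg 11) (Reg 14)) (Op Sub (Reg 11) (Reg 14))))))))) (rg', mem') (35 * n + 30)
      (\<lambda>(rg'', mem''). rg'' 15 = i \<and> rg'' 1 = T \<and> mem'' = mem \<and>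
        (\<forall>r. r \<notin> {10..16} \<longrightarrow> (rg''(15 := Suc i)) r = rg r) \<and>
        (rg''(15 := Suc i)) 12 = penalty_upto Y (Suc i) \<and> (rg''(15 := Suc i)) 13 = rg 13 \<and>
        (rg''(15 := Suc i)) 14 = 2 ^ Suc i)"
    unfolding penalty_upto_Suc p_def[symmetric] power2_eq_square d_def[symmetric]
    by (rule reaches_time, rule reaches_Seq', rule reaches_Assign, rule reaches_Seq',
        rule reaches_Assign, rule reaches_Seq', rule reaches_count_deg[where Y = Y], rule reaches_Assign)
      (use I rg' \<open>rg' 15 = i\<close> \<open>rg' 1 = T\<close> mem small small' w_pos p in
        \<open>simp_all add: d_def[symmetric]\<close>)
next
  show "Q (rg', mem')" if "mem' = mem \<and> (\<forall>r. r \<notin> {10..16} \<longrightarrow> rg' r = rg r) \<and>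
      rg' 12 = penalty_upto Y T \<and> rg' 13 = rg 13 \<and> rg' 14 = 2 ^ T" for rg' mem'
    using that Q by blast
next
  show "T * (35 * n + 30 + 8) + 6 \<le> n * (35 * n + 38) + 6"
    using mult_le_mono1[OF T_le, of "35 * n + 38"] by (simp add: add.commute)
qed (use rg n_bound T_le in \<open>auto\<close>)

lemma reaches_eval:
  assumes Q: "\<And>rg'. (\<And>r. r \<notin> {10..16} \<Longrightarrow> rg' r = rg r) \<Longrightarrow> rg' 12 = penalty_upto Y T \<Longrightarrow>
      rg' 13 = size_upto Y n \<Longrightarrow> Q (rg', mem)"
    and rg: "rg 0 = n" "rg 1 = T" "rg 2 = W" "rg 8 = 4 * n + 3"
    and mem: "\<And>a. a < 3 * n + 2 \<Longrightarrow> mem a = inp a" "\<And>j. j < n \<Longrightarrow> mem (4 * n + 3 + j) = of_bool (j \<in> Y)"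
  shows "reaches w eval_prog (rg, mem) (110 * (n + 1)\<^sup>2) Q"
  unfolding eval_prog_def
proof (rule reaches_time, rule reaches_Seq', rule reaches_Assign, rule reaches_Seq', rule reaches_Assign,
    rule reaches_Seq', rule reaches_vertex_loop[where Y = Y])
  fix rg'
  let ?rg = "rg(12 := expr_val w (rg, mem) (Lit 0),
    13 := expr_val w (rg(12 := expr_val w (rg, mem) (Lit 0)), mem) (Lit 0))"
  assume rg': "\<And>r. r \<notin> {10..16} \<Longrightarrow> rg' r = ?rg r" "rg' 12 = conflicts_upto Y n" "rg' 13 = size_upto Y n"
  have frame: "rg' r = rg r" if "r \<notin> {10..16}" for r
    using rg'(1)[OF that] that by auto
  have regs: "rg' 0 = n" "rg' 1 = T" "rg' 2 = W" "rg' 8 = 4 * n + 3"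
    using frame[of 0] frame[of 1] frame[of 2] frame[of 8] rg by simp_all
  show "reaches w (Seq (Assign 14 (Lit 1)) set_loop) (rg', mem) (2 + (n * (35 * n + 38) + 6)) Q"
  proof (rule reaches_time, rule reaches_Seq', rule reaches_Assign, rule reaches_set_loop[where Y = Y])
    fix rg'' assume *: "\<And>r. r \<notin> {10..16} \<Longrightarrow> rg'' r = (rg'(14 := expr_val w (rg', mem) (Lit 1))) r"
      "rg'' 12 = penalty_upto Y T" "rg'' 13 = (rg'(14 := expr_val w (rg', mem) (Lit 1))) 13"
    show "Q (rg'', mem)"
    proof (rule Q)
      show "rg'' r = rg r" if "r \<notin> {10..16}" for r
        using *(1)[OF that] frame[OF that] that by auto
    qed (use * rg'(3) in simp_all)
  qed (use regs rg'(2) mem w_pos in \<open>simp_all add: penalty_upto_def\<close>)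
qed (use rg mem in \<open>auto simp: power2_eq_square algebra_simps\<close>)

definition flipped :: "nat \<Rightarrow> nat set" where
  "flipped c = {j. j < n \<and> Suc j \<in> flips (n + 1) c K}"

text \<open>The junk cell \<open>4 * n + 2\<close> lies between the two ranges described for the
  final memory and is left unconstrained, so digits 0 need no bookkeeping.\<close>

lemma reaches_toggle:
  assumes Q: "\<And>rg' mem'. (\<And>r. r \<notin> {9, 16} \<Longrightarrow> rg' r = rg r) \<Longrightarrow>
      (\<And>a. a < 4 * n + 2 \<Longrightarrow> mem' a = mem a) \<Longrightarrow>
      (\<And>j. j < n \<Longrightarrow> mem' (4 * n + 3 + j) = of_bool (j \<in> sym_diff Y (flipped c))) \<Longrightarrow> Q (rg', mem')"
    and rg: "rg 0 = n" "rg 3 = K" "rg 5 = c" "rg 8 = 4 * n + 3" and c: "c < 2 ^ w"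
    and mem: "\<And>j. j < n \<Longrightarrow> mem (4 * n + 3 + j) = of_bool (j \<in> Y)"
  shows "reaches w toggle_prog (rg, mem) (40 * K + 8) Q"
  unfolding toggle_prog_def
proof (rule reaches_time, rule reaches_Seq', rule reaches_Assign,
    rule reaches_for_loop[where N = K and t = 32 and t' = "40 * K + 6" and I = "\<lambda>k rg' mem'.
      (\<forall>r. r \<notin> {9, 16} \<longrightarrow> rg' r = rg r) \<and> rg' 9 = c div (n + 1) ^ k \<and>
      (\<forall>a. a < 4 * n + 2 \<longrightarrow> mem' a = mem a) \<and>
      (\<forall>j<n. mem' (4 * n + 3 + j) = of_bool ((j \<in> Y) \<noteq> (Suc j \<in> flips (n + 1) c k)))"])
  fix k rg' mem'
  assume k: "k < K" "rg' 16 = k" "rg' 3 = K" and I: "(\<forall>r. r \<notin> {9, 16} \<longrightarrow> rg' r = rg r) \<and>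
      rg' 9 = c div (n + 1) ^ k \<and> (\<forall>a. a < 4 * n + 2 \<longrightarrow> mem' a = mem a) \<and>
      (\<forall>j<n. mem' (4 * n + 3 + j) = of_bool ((j \<in> Y) \<noteq> (Suc j \<in> flips (n + 1) c k)))"
  let ?addr = "Op Add (Op Sub (Reg 8) (Lit 1)) (Op Mod (Reg 9) (Op Add (Reg 0) (Lit 1)))"
  define d where "d = (c div (n + 1) ^ k) mod (n + 1)"
  have d: "d \<le> n"
    unfolding d_def using mod_less_divisor[of "n + 1" "c div (n + 1) ^ k"] by linarith
  have small: "1 < (2::nat) ^ w" "n + 1 < 2 ^ w" "d < 2 ^ w" "4 * n + 2 < 2 ^ w" "4 * n + 2 + d < 2 ^ w"
    using n_bound d by linarith+
  have rg': "rg' 0 = n" "rg' 8 = 4 * n + 3"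
    using I rg by auto
  have addr: "expr_val w (rg', mem') ?addr = 4 * n + 2 + d"
    using rg' I small w_pos by (simp add: d_def)
  have next_digit: "expr_val w (rg', m) (Op Div (Reg 9) (Op Add (Reg 0) (Lit 1))) = c div (n + 1) ^ Suc k" for m
  proof -
    have eq: "c div (n + 1) ^ Suc k = c div (n + 1) ^ k div (n + 1)"
      by (simp only: power_Suc2 div_mult2_eq)
    have "c div (n + 1) ^ k div (n + 1) \<le> c"
      by (meson div_le_dividend order_trans)
    then have "c div (n + 1) ^ k div (n + 1) < 2 ^ w"
      using c by linarith
    then show ?thesis
      unfolding eq using rg' I small w_pos by simp
  qed
  have cell: "expr_val w (rg', mem') (Op Sub (Lit 1) (Mem ?addr)) = 1 - mem' (4 * n + 2 + d)"
  proof -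
    have "1 - mem' (4 * n + 2 + d) < 2 ^ w"
      using small(1) by linarith
    then show ?thesis
      using w_pos addr by simp
  qed
  show "reaches w (Seq (Store ?addr (Op Sub (Lit 1) (Mem ?addr)))
      (Assign 9 (Op Div (Reg 9) (Op Add (Reg 0) (Lit 1))))) (rg', mem') 32
      (\<lambda>(rg'', mem''). rg'' 16 = k \<and> rg'' 3 = K \<and>
        (\<forall>r. r \<notin> {9, 16} \<longrightarrow> (rg''(16 := Suc k)) r = rg r) \<and> (rg''(16 := Suc k)) 9 = c div (n + 1) ^ Suc k \<and>
        (\<forall>a. a < 4 * n + 2 \<longrightarrow> mem'' a = mem a) \<and>
        (\<forall>j<n. mem'' (4 * n + 3 + j) = of_bool ((j \<in> Y) \<noteq> (Suc j \<in> flips (n + 1) c (Suc k)))))"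
  proof (rule reaches_time, rule reaches_Seq', rule reaches_StoreI[OF _ order_refl], rule reaches_Assign,
      unfold addr next_digit cell)
    have "(mem'(4 * n + 2 + d := 1 - mem' (4 * n + 2 + d))) (4 * n + 3 + j) =
        of_bool ((j \<in> Y) \<noteq> (Suc j \<in> flips (n + 1) c (Suc k)))" if j: "j < n" for j
    proof (cases "d = Suc j")
      case True
      then have addr_eq: "4 * n + 2 + d = 4 * n + 3 + j"
        by simp
      have old: "mem' (4 * n + 3 + j) = of_bool ((j \<in> Y) \<noteq> (Suc j \<in> flips (n + 1) c k))"
        using I j by blast
      have "Suc j \<in> flips (n + 1) c (Suc k) \<longleftrightarrow> Suc j \<notin> flips (n + 1) c k"
        using True d_def by auto
      then show ?thesis
        unfolding addr_eq fun_upd_same old by (auto simp del: flips.simps)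
    next
      case False
      then have "4 * n + 2 + d \<noteq> 4 * n + 3 + j"
        by simp
      then show ?thesis
        using I j False d_def by auto
    qed
    then show "case (rg'(9 := c div (n + 1) ^ Suc k), mem'(4 * n + 2 + d := 1 - mem' (4 * n + 2 + d))) of
      (rg'', mem'') \<Rightarrow> rg'' 16 = k \<and> rg'' 3 = K \<and>
        (\<forall>r. r \<notin> {9, 16} \<longrightarrow> (rg''(16 := Suc k)) r = rg r) \<and> (rg''(16 := Suc k)) 9 = c div (n + 1) ^ Suc k \<and>
        (\<forall>a. a < 4 * n + 2 \<longrightarrow> mem'' a = mem a) \<and>
        (\<forall>j<n. mem'' (4 * n + 3 + j) = of_bool ((j \<in> Y) \<noteq> (Suc j \<in> flips (n + 1) c (Suc k))))"
      using I k by (auto simp del: flips.simps)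
  qed auto
next
  show "Q (rg', mem')" if "(\<forall>r. r \<notin> {9, 16} \<longrightarrow> rg' r = rg r) \<and>
      rg' 9 = c div (n + 1) ^ K \<and> (\<forall>a. a < 4 * n + 2 \<longrightarrow> mem' a = mem a) \<and>
      (\<forall>j<n. mem' (4 * n + 3 + j) = of_bool ((j \<in> Y) \<noteq> (Suc j \<in> flips (n + 1) c K)))" for rg' mem'
    using that by (intro Q) (auto simp: flipped_def)
qed (use rg mem w_gt K_bound in auto)

end

text \<open>Doubling \<open>W\<close> from 1 until it reaches \<open>n\<close> computes
  \<open>T\<close>, the rounded-up binary logarithm, in register 1, which is initially 0. For
  \<open>n < N0\<close> the choice \<open>K = N0\<close> lets a move toggle every edge.\<close>

definition setup_prog :: "nat \<Rightarrow> nat \<Rightarrow> prog" where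
  "setup_prog N0 K0 =
     Seq (Assign 0 (Mem (Lit 1)))
     (Seq (Assign 7 (Op Add (Op Mul (Lit 3) (Reg 0)) (Lit 2)))
     (Seq (Assign 8 (Op Add (Op Mul (Lit 4) (Reg 0)) (Lit 3)))
     (Seq (Assign 2 (Lit 1))
     (Seq (While (Op Less (Reg 2) (Reg 0))
       (Seq (Assign 2 (Op Add (Reg 2) (Reg 2))) (Assign 1 (Op Add (Reg 1) (Lit 1)))))
     (Seq (Cond (Op Less (Reg 0) (Lit N0)) (Assign 3 (Lit N0)) (Assign 3 (Lit K0)))
     (Seq (Assign 4 (Lit 1))
       (for_loop 16 3 (Assign 4 (Op Mul (Reg 4) (Op Add (Reg 0) (Lit 1)))))))))))"

text \<open>Every trial starts from a fresh copy, so a rejected move needs no undoing. Acceptance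
  restarts the enumeration at 0; when register 5 reaches \<open>B\<close>, all moves have therefore
  failed against one and the same solution.\<close>

definition step_prog :: prog where
  "step_prog =
     Seq (copy_prog 7 8)
     (Seq toggle_prog
     (Seq eval_prog
       (Cond (Op Less (Reg 6) (Op Sub (Op Mul (Reg 2) (Reg 13)) (Reg 12)))
         (Seq (Assign 6 (Op Sub (Op Mul (Reg 2) (Reg 13)) (Reg 12)))
           (Seq (Assign 5 (Lit 0)) (copy_prog 8 7)))
         (Assign 5 (Op Add (Reg 5) (Lit 1))))))"

text \<open>Register 18 supplies the address 0: the final copy puts the solution into the cells
  where the output is read, overwriting the input there.\<close>

definition search_prog :: "nat \<Rightarrow> nat \<Rightarrow> prog" where
  "search_prog N0 K0 =
     Seq (setup_prog N0 K0) (Seq (While (Op Less (Reg 5) (Reg 4)) step_prog) (copy_prog 7 18))"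

section \<open>Correctness and cost of the search loop\<close>

context machine
begin

text \<open>The candidate cells, the junk cell and the scratch registers 9 to 16 are left open
  because each step recomputes what it uses of them.\<close>

definition config :: "nat set \<Rightarrow> nat \<Rightarrow> (nat \<Rightarrow> nat) \<Rightarrow> (nat \<Rightarrow> nat) \<Rightarrow> bool" where
  "config X c rg mem \<longleftrightarrow> X \<subseteq> {..<n} \<and> rg 0 = n \<and> rg 1 = T \<and> rg 2 = W \<and> rg 3 = K \<and> rg 4 = B \<and>
     rg 5 = c \<and> rg 6 = score X \<and> rg 7 = 3 * n + 2 \<and> rg 8 = 4 * n + 3 \<and> rg 18 = 0 \<and>
     (\<forall>a<3 * n + 2. mem a = inp a) \<and> (\<forall>j<n. mem (3 * n + 2 + j) = of_bool (j \<in> X))"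

lemma score_le: "score Y \<le> W * n"
proof -
  have "W * size_upto Y n \<le> W * n"
    by (intro mult_le_mono2 size_upto_le_n)
  then show ?thesis
    unfolding score_def by linarith
qed

lemma W_mult_n_less: "W * n < 2 ^ w"
proof (cases "n = 0")
  case False
  then have "W * n \<le> W * n * n" "W * n * n \<le> 4 * n * (W * n * n)"
    by auto
  then show ?thesis
    using W_bound by linarith
qed simp

lemma reaches_step:
  assumes cfg: "config X c rg mem" and c: "c < B"
    and accept: "\<And>rg' mem'. score X < score (sym_diff X (flipped c)) \<Longrightarrow>
      config (sym_diff X (flipped c)) 0 rg' mem' \<Longrightarrow> Q (rg', mem')"
    and reject: "\<And>rg' mem'. score (sym_diff X (flipped c)) \<le> score X \<Longrightarrow>
      config X (Suc c) rg' mem' \<Longrightarrow> Q (rg', mem')"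
  shows "reaches w step_prog (rg, mem) (130 * (n + 1)\<^sup>2 + 40 * K + 20) Q"
proof -
  let ?Y = "sym_diff X (flipped c)"
  let ?val = "Op Sub (Op Mul (Reg 2) (Reg 13)) (Reg 12)"
  let ?mem = "\<lambda>a. if 4 * n + 3 \<le> a \<and> a < 4 * n + 3 + n then mem (3 * n + 2 + (a - (4 * n + 3))) else mem a"
  let ?decide = "Cond (Op Less (Reg 6) ?val)
      (Seq (Assign 6 ?val) (Seq (Assign 5 (Lit 0)) (copy_prog 8 7)))
      (Assign 5 (Op Add (Reg 5) (Lit 1)))"
  have X: "X \<subseteq> {..<n}" and Y: "?Y \<subseteq> {..<n}"
    using cfg by (auto simp: config_def flipped_def)
  have rg: "rg 0 = n" "rg 1 = T" "rg 2 = W" "rg 3 = K" "rg 4 = B" "rg 5 = c" "rg 6 = score X"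
    "rg 7 = 3 * n + 2" "rg 8 = 4 * n + 3" "rg 18 = 0"
    and mem: "\<And>a. a < 3 * n + 2 \<Longrightarrow> mem a = inp a" "\<And>j. j < n \<Longrightarrow> mem (3 * n + 2 + j) = of_bool (j \<in> X)"
    using cfg by (auto simp: config_def)
  have decide: "reaches w ?decide (rg', mem') (16 * n + 22) Q"
    if frame: "\<And>r. r \<notin> {9..16} \<Longrightarrow> rg' r = rg r"
      and vals: "rg' 12 = penalty_upto ?Y T" "rg' 13 = size_upto ?Y n"
      and mem': "\<And>a. a < 4 * n + 2 \<Longrightarrow> mem' a = mem a"
        "\<And>j. j < n \<Longrightarrow> mem' (4 * n + 3 + j) = of_bool (j \<in> ?Y)" for rg' mem'
  proof -
    have rg': "rg' 0 = n" "rg' 1 = T" "rg' 2 = W" "rg' 3 = K" "rg' 4 = B" "rg' 5 = c" "rg' 6 = score X"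
      "rg' 7 = 3 * n + 2" "rg' 8 = 4 * n + 3" "rg' 18 = 0"
      using rg frame by auto
    have "W * size_upto ?Y n \<le> W * n"
      by (intro mult_le_mono2 size_upto_le_n)
    then have "W * size_upto ?Y n < 2 ^ w" "score ?Y < 2 ^ w"
      using W_mult_n_less score_le[of ?Y] by linarith+
    then have val: "expr_val w (rg', mem') ?val = score ?Y"
      using vals rg' by (simp add: score_def)
    show ?thesis
    proof (rule reaches_Cond)
      assume "expr_val w (rg', mem') (Op Less (Reg 6) ?val) \<noteq> 0"
      then have less: "score X < score ?Y"
        using val rg' by (auto split: if_splits)
      show "reaches w (Seq (Assign 6 ?val) (Seq (Assign 5 (Lit 0)) (copy_prog 8 7))) (rg', mem') (16 * n + 14) Q"
      proof (rule reaches_time, rule reaches_Seq', rule reaches_Assign, rule reaches_Seq', rule reaches_Assign,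
          rule reaches_copy[where n = n and t = "16 * n + 6"], unfold val)
        show "Q ((rg'(6 := score ?Y, 5 := expr_val w (rg'(6 := score ?Y), mem') (Lit 0)))(16 := n),
          \<lambda>a. if (rg'(6 := score ?Y, 5 := expr_val w (rg'(6 := score ?Y), mem') (Lit 0))) 7 \<le> a \<and>
              a < (rg'(6 := score ?Y, 5 := expr_val w (rg'(6 := score ?Y), mem') (Lit 0))) 7 + n
            then mem' ((rg'(6 := score ?Y, 5 := expr_val w (rg'(6 := score ?Y), mem') (Lit 0))) 8 +
              (a - (rg'(6 := score ?Y, 5 := expr_val w (rg'(6 := score ?Y), mem') (Lit 0))) 7)) else mem' a)"
          by (rule accept[OF less]) (use Y rg' mem' mem in \<open>simp add: config_def\<close>)
      qed (use rg' n_bound w_pos in simp_all)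
    next
      assume "expr_val w (rg', mem') (Op Less (Reg 6) ?val) = 0"
      then have le: "score ?Y \<le> score X"
        using val rg' w_gt by (auto split: if_splits)
      have "Suc c < 2 ^ w"
        using c B_bound by linarith
      then show "reaches w (Assign 5 (Op Add (Reg 5) (Lit 1))) (rg', mem') (16 * n + 14) Q"
        by (intro reaches_AssignI reject[OF le])
          (use X rg' mem' mem w_pos in \<open>simp_all add: config_def\<close>)
    qed simp
  qed
  show ?thesis
    unfolding step_prog_def
  proof (rule reaches_Seq[where ?t2.0 = "40 * K + 8 + (110 * (n + 1)\<^sup>2 + (16 * n + 22))"],
      rule reaches_copy[where n = n and t = "16 * n + 6"], goal_cases)
    \<comment> \<open>The ninth premise of \<open>reaches_copy\<close> is its postcondition, here
      the run of the rest of the step.\<close>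
    case 9
    have "reaches w toggle_prog (rg(16 := n), ?mem) (40 * K + 8) (\<lambda>s'. reaches w (Seq eval_prog ?decide) s'
        (110 * (n + 1)\<^sup>2 + (16 * n + 22)) Q)"
    proof (rule reaches_toggle[where Y = X and c = c])
      fix rg1 mem1
      assume rg1: "\<And>r. r \<notin> {9, 16} \<Longrightarrow> rg1 r = (rg(16 := n)) r"
        and mem1: "\<And>a. a < 4 * n + 2 \<Longrightarrow> mem1 a = ?mem a"
          "\<And>j. j < n \<Longrightarrow> mem1 (4 * n + 3 + j) = of_bool (j \<in> ?Y)"
      have regs: "rg1 0 = n" "rg1 1 = T" "rg1 2 = W" "rg1 8 = 4 * n + 3"
        using rg1[of 0] rg1[of 1] rg1[of 2] rg1[of 8] rg by simp_all
      have below: "mem1 a = mem a" if "a < 4 * n + 2" for a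
        using mem1(1)[OF that] that by simp
      show "reaches w (Seq eval_prog ?decide) (rg1, mem1) (110 * (n + 1)\<^sup>2 + (16 * n + 22)) Q"
      proof (rule reaches_Seq', rule reaches_eval[where Y = ?Y])
        fix rg2 assume rg2: "\<And>r. r \<notin> {10..16} \<Longrightarrow> rg2 r = rg1 r"
          "rg2 12 = penalty_upto ?Y T" "rg2 13 = size_upto ?Y n"
        show "reaches w ?decide (rg2, mem1) (16 * n + 22) Q"
        proof (rule decide[OF _ rg2(2,3) below mem1(2)])
          show "rg2 r = rg r" if "r \<notin> {9..16}" for r
            using rg2(1)[of r] rg1[of r] that by auto
        qed
      next
        show "mem1 a = inp a" if "a < 3 * n + 2" for a
          using below[of a] mem(1)[OF that] that by simp
      qed (use regs mem1(2) in auto)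
    qed (use rg mem c B_bound in auto)
    then show ?case
      unfolding rg
      by (rule reaches_Seq) (rule order_refl)
  qed (use rg n_bound in \<open>auto simp: power2_eq_square\<close>)
qed

text \<open>At most \<open>W * n\<close> improvements separate at most \<open>W * n + 1\<close>
  phases of at most \<open>B + 1\<close> trials; the last factor is the cost of a trial including
  the loop test.\<close>

definition search_time :: nat where
  "search_time = (W * n + 1) * (B + 1) * (130 * (n + 1)\<^sup>2 + 40 * K + 24) + 4"

lemma reaches_search_loop:
  assumes cfg: "config {} 0 rg mem"
    and Q: "\<And>X rg' mem'. config X B rg' mem' \<Longrightarrow> X = {} \<or> 0 < score X \<Longrightarrow>
      (\<And>c. c < B \<Longrightarrow> score (sym_diff X (flipped c)) \<le> score X) \<Longrightarrow> Q (rg', mem')"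
  shows "reaches w (While (Op Less (Reg 5) (Reg 4)) step_prog) (rg, mem) search_time Q"
proof -
  \<comment> \<open>The third conjunct records that the solution is the initial one or was accepted
    with a positive score; score 0 alone would not exclude a non-matching.\<close>
  define I where "I = (\<lambda>(rg, mem). \<exists>X c. config X c rg mem \<and> c \<le> B \<and> (X = {} \<or> 0 < score X) \<and>
    (\<forall>c'<c. score (sym_diff X (flipped c')) \<le> score X))"
  \<comment> \<open>A lexicographic measure as a single number: missing score first, then remaining
    moves. The factor \<open>B + 1\<close> pays for resetting the counter after an
    improvement.\<close>
  define \<mu> where "\<mu> s = (W * n - fst s 6) * (B + 1) + (B - fst s 5)" for s :: state
  show ?thesis
  proof (rule reaches_While[where I = I and \<mu> = \<mu> and t = "130 * (n + 1)\<^sup>2 + 40 * K + 20"])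
    show "I (rg, mem)"
      unfolding I_def using cfg by auto
  next
    fix s assume s: "I s" "expr_val w s (Op Less (Reg 5) (Reg 4)) = 0"
    then obtain X c rg' mem' where *: "s = (rg', mem')" "config X c rg' mem'" "c \<le> B"
      "X = {} \<or> 0 < score X" "\<forall>c'<c. score (sym_diff X (flipped c')) \<le> score X"
      by (auto simp: I_def)
    moreover from s(2) *(1,2,3) have "c = B"
      using w_gt by (auto simp: config_def split: if_splits)
    ultimately show "Q s"
      using Q by auto
  next
    fix s assume s: "I s" "expr_val w s (Op Less (Reg 5) (Reg 4)) \<noteq> 0"
    then obtain X c rg' mem' where *: "s = (rg', mem')" "config X c rg' mem'" "c \<le> B"
      "X = {} \<or> 0 < score X" "\<forall>c'<c. score (sym_diff X (flipped c')) \<le> score X"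
      by (auto simp: I_def)
    from s(2) *(1,2) have c: "c < B"
      by (auto simp: config_def split: if_splits)
    have \<mu>: "\<mu> s = (W * n - score X) * (B + 1) + (B - c)"
      using *(1,2) by (simp add: \<mu>_def config_def)
    show "reaches w step_prog s (130 * (n + 1)\<^sup>2 + 40 * K + 20) (\<lambda>s'. I s' \<and> \<mu> s' < \<mu> s)"
      unfolding *(1)
    proof (rule reaches_step[OF *(2) c])
      fix rg1 mem1
      let ?Y = "sym_diff X (flipped c)"
      assume less: "score X < score ?Y" and cfg1: "config ?Y 0 rg1 mem1"
      have "Suc (W * n - score ?Y) \<le> W * n - score X"
        using less score_le[of ?Y] by linarith
      then have "Suc (W * n - score ?Y) * (B + 1) \<le> (W * n - score X) * (B + 1)"
        by (rule mult_le_mono1)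
      then have "(W * n - score ?Y) * (B + 1) + B < \<mu> s"
        unfolding \<mu> mult_Suc by linarith
      moreover have "\<mu> (rg1, mem1) = (W * n - score ?Y) * (B + 1) + B"
        using cfg1 by (simp add: \<mu>_def config_def)
      ultimately have "\<mu> (rg1, mem1) < \<mu> s"
        by simp
      moreover have "I (rg1, mem1)"
        unfolding I_def using cfg1 less by (intro case_prodI exI[of _ ?Y] exI[of _ 0]) auto
      ultimately show "I (rg1, mem1) \<and> \<mu> (rg1, mem1) < \<mu> (rg', mem')"
        using *(1) by simp
    next
      fix rg1 mem1
      assume le: "score (sym_diff X (flipped c)) \<le> score X" and cfg1: "config X (Suc c) rg1 mem1"
      have "\<mu> (rg1, mem1) < \<mu> s"
        using cfg1 c unfolding \<mu> by (simp add: \<mu>_def config_def)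
      moreover have "\<forall>c'<Suc c. score (sym_diff X (flipped c')) \<le> score X"
        using *(5) le less_Suc_eq by blast
      then have "I (rg1, mem1)"
        unfolding I_def using cfg1 c *(4) by (intro case_prodI exI[of _ X] exI[of _ "Suc c"]) simp
      ultimately show "I (rg1, mem1) \<and> \<mu> (rg1, mem1) < \<mu> (rg', mem')"
        using *(1) by simp
    qed
  next
    have "\<mu> (rg, mem) \<le> W * n * (B + 1) + (B + 1)"
      unfolding \<mu>_def by (intro add_mono mult_le_mono1) auto
    also have "\<dots> = (W * n + 1) * (B + 1)"
      by simp
    finally have *: "\<mu> (rg, mem) * (130 * (n + 1)\<^sup>2 + 40 * K + 24) \<le>
        (W * n + 1) * (B + 1) * (130 * (n + 1)\<^sup>2 + 40 * K + 24)"
      by (rule mult_le_mono1)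
    have eqs: "130 * (n + 1)\<^sup>2 + 40 * K + 20 + 3 + 1 = 130 * (n + 1)\<^sup>2 + 40 * K + 24"
      "expr_time (Op Less (Reg 5) (Reg 4)) = 3"
      by simp_all
    show "\<mu> (rg, mem) * (130 * (n + 1)\<^sup>2 + 40 * K + 20 + expr_time (Op Less (Reg 5) (Reg 4)) + 1) +
        expr_time (Op Less (Reg 5) (Reg 4)) + 1 \<le> search_time"
      unfolding search_time_def eqs using * by linarith
  qed
qed

lemma score_empty: "score {} = 0"
  by (simp add: score_def size_upto_def deg_def)

text \<open>The premise \<open>T\<close> has the shape of the test of the doubling loop, which
  therefore stops after exactly \<open>T\<close> rounds.\<close>

lemma reaches_setup:
  assumes T: "\<And>t. 2 ^ t < n \<longleftrightarrow> t < T" and K: "K = (if n < N0 then N0 else K0)"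
    and lits: "N0 < 2 ^ w" "K0 < 2 ^ w"
    and mem: "mem 1 = n" "\<And>a. a < 3 * n + 2 \<Longrightarrow> mem a = inp a" "\<And>a. a \<ge> 3 * n + 2 \<Longrightarrow> mem a = 0"
    and Q: "\<And>rg. config {} 0 rg mem \<Longrightarrow> Q (rg, mem)"
  shows "reaches w (setup_prog N0 K0) (\<lambda>_. 0, mem) (12 * n + 14 * K + 50) Q"
proof -
  let ?rg = "\<lambda>t. (\<lambda>_ :: nat. 0 :: nat)(0 := n, 7 := 3 * n + 2, 8 := 4 * n + 3, 2 := 2 ^ t, 1 := t)"
  let ?loop = "While (Op Less (Reg 2) (Reg 0))
       (Seq (Assign 2 (Op Add (Reg 2) (Reg 2))) (Assign 1 (Op Add (Reg 1) (Lit 1))))"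
  let ?kb = "Seq (Cond (Op Less (Reg 0) (Lit N0)) (Assign 3 (Lit N0)) (Assign 3 (Lit K0)))
     (Seq (Assign 4 (Lit 1)) (for_loop 16 3 (Assign 4 (Op Mul (Reg 4) (Op Add (Reg 0) (Lit 1))))))"
  have small: "1 < (2::nat) ^ w" "n < 2 ^ w" "3 < (2::nat) ^ w" "4 < (2::nat) ^ w" "2 < (2::nat) ^ w"
    "3 * n < 2 ^ w" "3 * n + 2 < 2 ^ w" "4 * n < 2 ^ w" "4 * n + 3 < 2 ^ w" "n + 1 < 2 ^ w"
    using n_bound by linarith+
  have powers: "reaches w (for_loop 16 3 (Assign 4 (Op Mul (Reg 4) (Op Add (Reg 0) (Lit 1)))))
      ((?rg T)(3 := K, 4 := 1), mem) (14 * K + 6) Q"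
  proof (rule reaches_for_loop[where N = K and t = 6 and I = "\<lambda>k rg' mem'. mem' = mem \<and>
      rg' = (?rg T)(3 := K, 4 := (n + 1) ^ k, 16 := k)"])
    fix k rg' mem'
    assume k: "k < K" and I: "mem' = mem \<and> rg' = (?rg T)(3 := K, 4 := (n + 1) ^ k, 16 := k)"
    have "(n + 1) ^ k * (n + 1) = (n + 1) ^ Suc k"
      by simp
    also have "\<dots> \<le> (n + 1) ^ K"
      using k by (intro power_increasing) auto
    finally have "(n + 1) ^ k * (n + 1) < 2 ^ w"
      using B B_bound by linarith
    then have "expr_val w (rg', mem') (Op Mul (Reg 4) (Op Add (Reg 0) (Lit 1))) = (n + 1) ^ Suc k"
      using I small(1,10) w_pos by (simp add: mult.commute)
    then show "reaches w (Assign 4 (Op Mul (Reg 4) (Op Add (Reg 0) (Lit 1)))) (rg', mem') 6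
      (\<lambda>(rg'', mem''). rg'' 16 = k \<and> rg'' 3 = K \<and> mem'' = mem \<and>
        rg''(16 := Suc k) = (?rg T)(3 := K, 4 := (n + 1) ^ Suc k, 16 := Suc k))"
      using I unfolding I by (intro reaches_AssignI) (auto simp: fun_eq_iff)
  next
    show "Q (rg', mem')" if "mem' = mem \<and> rg' = (?rg T)(3 := K, 4 := (n + 1) ^ K, 16 := K)" for rg' mem'
    proof -
      have "config {} 0 rg' mem"
        unfolding config_def score_empty using that mem W B by simp
      then show ?thesis
        using that Q by simp
    qed
  qed (use K_bound small in \<open>auto simp: fun_eq_iff\<close>)
  have kb: "reaches w ?kb (?rg T, mem) (14 * K + 14) Q"
  proof (rule reaches_Seq)
    show "reaches w (Cond (Op Less (Reg 0) (Lit N0)) (Assign 3 (Lit N0)) (Assign 3 (Lit K0))) (?rg T, mem) 6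
      (\<lambda>s'. reaches w (Seq (Assign 4 (Lit 1))
        (for_loop 16 3 (Assign 4 (Op Mul (Reg 4) (Op Add (Reg 0) (Lit 1)))))) s' (14 * K + 8) Q)"
    proof (rule reaches_Cond[where t = 2])
      have cont: "reaches w (Seq (Assign 4 (Lit 1)) (for_loop 16 3 (Assign 4 (Op Mul (Reg 4) (Op Add (Reg 0) (Lit 1))))))
          ((?rg T)(3 := K), mem) (14 * K + 8) Q"
        by (rule reaches_Seq[OF reaches_Assign, where ?t2.0 = "14 * K + 6"])
          (use powers small(1) w_pos in simp_all)
      show "reaches w (Assign 3 (Lit N0)) (?rg T, mem) 2 (\<lambda>s'. reaches w (Seq (Assign 4 (Lit 1))
          (for_loop 16 3 (Assign 4 (Op Mul (Reg 4) (Op Add (Reg 0) (Lit 1)))))) s' (14 * K + 8) Q)"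
        if "expr_val w (?rg T, mem) (Op Less (Reg 0) (Lit N0)) \<noteq> 0"
        using that cont lits K by (intro reaches_AssignI) (auto split: if_splits)
      show "reaches w (Assign 3 (Lit K0)) (?rg T, mem) 2 (\<lambda>s'. reaches w (Seq (Assign 4 (Lit 1))
          (for_loop 16 3 (Assign 4 (Op Mul (Reg 4) (Op Add (Reg 0) (Lit 1)))))) s' (14 * K + 8) Q)"
        if "expr_val w (?rg T, mem) (Op Less (Reg 0) (Lit N0)) = 0"
        using that cont lits K small(1) w_pos by (intro reaches_AssignI) (auto split: if_splits)
    qed simp
  qed simp
  have loop: "reaches w ?loop (?rg 0, mem) (12 * n + 4) (\<lambda>s'. reaches w ?kb s' (14 * K + 14) Q)"
  proof (rule reaches_While[where I = "\<lambda>s. \<exists>t\<le>T. s = (?rg t, mem)" and \<mu> = "\<lambda>s. T - fst s 1" and t = 8])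
    fix s assume s: "\<exists>t\<le>T. s = (?rg t, mem)" "expr_val w s (Op Less (Reg 2) (Reg 0)) \<noteq> 0"
    then obtain t where t: "s = (?rg t, mem)" "t < T"
      using T by (auto split: if_splits)
    have "(2::nat) ^ Suc t \<le> 2 ^ T"
      using t(2) by (intro power_increasing) auto
    then have bounds: "(2::nat) ^ t + 2 ^ t < 2 ^ w" "t + 1 < 2 ^ w"
      using t(2) W W_bound T_le small by auto
    show "reaches w (Seq (Assign 2 (Op Add (Reg 2) (Reg 2))) (Assign 1 (Op Add (Reg 1) (Lit 1)))) s 8
        (\<lambda>s'. (\<exists>t\<le>T. s' = (?rg t, mem)) \<and> T - fst s' 1 < T - fst s 1)"
      unfolding t(1)
      by (rule reaches_time, rule reaches_Seq', rule reaches_Assign, rule reaches_Assign)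
        (use t(2) bounds w_pos in \<open>auto intro!: exI[of _ "Suc t"] simp: fun_eq_iff\<close>)
  next
    fix s assume s: "\<exists>t\<le>T. s = (?rg t, mem)" "expr_val w s (Op Less (Reg 2) (Reg 0)) = 0"
    then have "s = (?rg T, mem)"
      using T small(1) w_pos by (auto split: if_splits simp: le_less)
    then show "reaches w ?kb s (14 * K + 14) Q"
      using kb by simp
  qed (use T_le in auto)
  have loop': "reaches w ?loop (rg0, mem) (12 * n + 4) (\<lambda>s'. reaches w ?kb s' (14 * K + 14) Q)"
    if "rg0 = ?rg 0" for rg0
    using loop that by simp
  show ?thesis
    unfolding setup_prog_def
    by (rule reaches_time, rule reaches_Seq', rule reaches_Assign, rule reaches_Seq', rule reaches_Assign,
        rule reaches_Seq', rule reaches_Assign, rule reaches_Seq', rule reaches_Assign,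
        rule reaches_Seq', rule loop')
      (use mem(1) small w_pos in \<open>simp_all add: fun_eq_iff\<close>)
qed

lemma reaches_search:
  assumes T: "\<And>t. 2 ^ t < n \<longleftrightarrow> t < T" and K: "K = (if n < N0 then N0 else K0)"
    and lits: "N0 < 2 ^ w" "K0 < 2 ^ w"
    and mem: "mem 1 = n" "\<And>a. a < 3 * n + 2 \<Longrightarrow> mem a = inp a" "\<And>a. a \<ge> 3 * n + 2 \<Longrightarrow> mem a = 0"
  shows "reaches w (search_prog N0 K0) (\<lambda>_. 0, mem) (28 * n + 14 * K + 56 + search_time)
    (\<lambda>(rg', mem'). \<exists>X\<subseteq>{..<n}. (\<forall>j<n. mem' j = of_bool (j \<in> X)) \<and> (X = {} \<or> 0 < score X) \<and>
      (\<forall>c<B. score (sym_diff X (flipped c)) \<le> score X))"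
  unfolding search_prog_def
proof (rule reaches_time, rule reaches_Seq', rule reaches_setup[OF T K lits mem], assumption, assumption,
    rule reaches_Seq', rule reaches_search_loop, assumption)
  fix X rg' mem'
  assume cfg: "config X B rg' mem'" and X: "X = {} \<or> 0 < score X"
    "\<And>c. c < B \<Longrightarrow> score (sym_diff X (flipped c)) \<le> score X"
  show "reaches w (copy_prog 7 18) (rg', mem') (16 * n + 6)
    (\<lambda>(rg', mem'). \<exists>X\<subseteq>{..<n}. (\<forall>j<n. mem' j = of_bool (j \<in> X)) \<and> (X = {} \<or> 0 < score X) \<and>
      (\<forall>c<B. score (sym_diff X (flipped c)) \<le> score X))"
    by (rule reaches_copy[where n = n])
      (use cfg X n_bound w_pos in \<open>auto simp: config_def intro!: exI[of _ X]\<close>)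
qed simp

end

section \<open>From scores to local optima\<close>

lemma flips_add_high_digit:
  assumes "l \<le> k" "b > 0"
  shows "flips b (c + z * b ^ k) l = flips b c l"
  using assms(1)
proof (induction l)
  case (Suc l)
  have shift: "z * b ^ k = z * b ^ (k - Suc l) * b * b ^ l"
    using Suc.prems by (simp add: mult.assoc flip: power_Suc power_add)
  have "(c + z * b ^ k) div b ^ l = c div b ^ l + z * b ^ (k - Suc l) * b"
    unfolding shift using assms(2) by simp
  then show ?case
    using Suc by simp
qed simp

text \<open>A small \<open>Z\<close> is encoded with one digit fewer, the leading digit 0 then
  affecting only the element 0. Otherwise the leading digit is spent on some \<open>z\<close> of
  \<open>Z\<close>, which leaves the lower digits unchanged.\<close>

lemma flips_surj:
  assumes "finite Z" "Z \<subseteq> {1..<b}" "card Z \<le> k" "b > 0"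
  shows "\<exists>c<b ^ k. flips b c k - {0} = Z"
  using assms(1-3)
proof (induction k arbitrary: Z)
  case (Suc k)
  show ?case
  proof (cases "card Z \<le> k")
    case True
    then obtain c where c: "c < b ^ k" "flips b c k - {0} = Z"
      using Suc by blast
    have "c < b ^ Suc k"
      using c(1) assms(4) by (simp add: less_le_trans)
    moreover have "flips b c (Suc k) - {0} = Z"
      using c by auto
    ultimately show ?thesis
      by blast
  next
    case False
    then obtain z where z: "z \<in> Z"
      by (cases "Z = {}") auto
    have zb: "z < b" "z \<noteq> 0"
      using z Suc.prems(2) by auto
    have "card (Z - {z}) \<le> k"
      using Suc.prems z by simp
    then obtain c where c: "c < b ^ k" "flips b c k - {0} = Z - {z}"
      using Suc.IH[of "Z - {z}"] Suc.prems by auto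
    let ?c = "c + z * b ^ k"
    have "?c < Suc z * b ^ k"
      using c(1) by simp
    also have "\<dots> \<le> b * b ^ k"
      using zb by (intro mult_le_mono1) simp
    finally have "?c < b ^ Suc k"
      by simp
    moreover have "(?c div b ^ k) mod b = z"
      using c(1) zb by simp
    then have "flips b ?c (Suc k) = sym_diff (flips b c k) {z}"
      using flips_add_high_digit[OF order_refl assms(4)] by simp
    then have "flips b ?c (Suc k) - {0} = Z"
      using c(2) z zb by auto
    ultimately show ?thesis
      by blast
  qed
qed simp

lemma (in machine) flipped_surj:
  assumes "Z \<subseteq> {..<n}" "card Z \<le> K"
  shows "\<exists>c<B. flipped c = Z"
proof -
  have "finite Z"
    using assms(1) finite_subset by blast
  moreover have "card (Suc ` Z) = card Z"
    by (simp add: card_image)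
  ultimately obtain c where c: "c < (n + 1) ^ K" "flips (n + 1) c K - {0} = Suc ` Z"
    using flips_surj[of "Suc ` Z" "n + 1" K] assms by fastforce
  have "j \<in> flipped c \<longleftrightarrow> j \<in> Z" for j
  proof -
    have "Suc j \<in> flips (n + 1) c K \<longleftrightarrow> Suc j \<in> Suc ` Z"
      unfolding c(2)[symmetric] by simp
    then show ?thesis
      using assms(1) by (auto simp: flipped_def)
  qed
  then show ?thesis
    using c(1) B by blast
qed

section \<open>Decoding the instance and interpreting the scores\<close>

lemma position_nth:
  assumes "distinct xs" "x \<in> set xs"
  shows "position xs x < length xs" "xs ! position xs x = x"
proof -
  obtain i where i: "i < length xs" "xs ! i = x"
    using assms(2) by (auto simp: in_set_conv_nth)
  then have "position xs x = i"
    unfolding position_def using assms(1) by (intro the_equality) (auto simp: nth_eq_iff_index_eq)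
  then show "position xs x < length xs" "xs ! position xs x = x"
    using i by simp_all
qed

lemma position_eq_iff:
  assumes "distinct xs" "x \<in> set xs" "y \<in> set xs"
  shows "position xs x = position xs y \<longleftrightarrow> x = y"
  using position_nth[OF assms(1)] assms(2,3) by metis

lemma set_number_eq_iff:
  assumes "disjoint_family_on S {1..T}" "i \<in> {1..T}"
  shows "set_number T S e = i \<longleftrightarrow> e \<in> S i"
proof -
  have unique: "k = l" if "k \<in> {1..T}" "l \<in> {1..T}" "e \<in> S k" "e \<in> S l" for k l
    using assms(1) that unfolding disjoint_family_on_def by blast
  show ?thesis
  proof (cases "\<exists>k\<in>{1..T}. e \<in> S k")
    case True
    then obtain k where k: "k \<in> {1..T}" "e \<in> S k"
      by blast
    then have "(THE i. i \<in> {1..T} \<and> e \<in> S i) = k"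
      using unique by (intro the_equality) auto
    then have "set_number T S e = k"
      using True by (simp add: set_number_def)
    then show ?thesis
      using k unique assms(2) by blast
  next
    case False
    then show ?thesis
      using assms(2) by (auto simp: set_number_def)
  qed
qed

lemma nth_concat_triples:
  assumes "j < length xs" "f < 3"
  shows "concat (map (\<lambda>e. [g0 e, g1 e, g2 e]) xs) ! (3 * j + f) = [g0 (xs ! j), g1 (xs ! j), g2 (xs ! j)] ! f"
  using assms(1)
proof (induction xs arbitrary: j)
  case (Cons x xs)
  show ?case
  proof (cases j)
    case 0
    moreover have "f = 0 \<or> f = 1 \<or> f = 2"
      using assms(2) by linarith
    ultimately show ?thesis
      by auto
  next
    case (Suc i)
    have "3 * j + f = Suc (Suc (Suc (3 * i + f)))"
      using Suc by simp
    then show ?thesis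
      using Cons Suc by simp
  qed
qed simp

lemma length_concat_triples: "length (concat (map (\<lambda>e. [g0 e, g1 e, g2 e]) xs)) = 3 * length xs"
  by (induction xs) auto

locale encoded_instance = machine +
  fixes L R :: "'v set" and E :: "('v \<times> 'v) set" and S :: "nat \<Rightarrow> ('v \<times> 'v) set" and us vs es
  assumes graph: "bipartite_graph L R E" and card_L: "card L \<le> n" and card_R: "card R \<le> n"
    and lists: "enumerates us L" "enumerates vs R" "enumerates es E" and card_E: "card E = n"
    and disjoint: "disjoint_family_on S {1..T}"
    and inp: "\<And>j. j < n \<Longrightarrow> inp (3 * j + 2) = position us (fst (es ! j))"
      "\<And>j. j < n \<Longrightarrow> inp (3 * j + 3) = position vs (snd (es ! j))"
      "\<And>j. j < n \<Longrightarrow> inp (3 * j + 4) = set_number T S (es ! j)"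
begin

lemma length_es: "length es = n"
  using lists(3) card_E distinct_card[of es] by (simp add: enumerates_def)

lemma es_inj: "i < n \<Longrightarrow> j < n \<Longrightarrow> es ! i = es ! j \<longleftrightarrow> i = j"
  using lists(3) length_es by (simp add: enumerates_def nth_eq_iff_index_eq)

lemma inj_on_es: "X \<subseteq> {..<n} \<Longrightarrow> inj_on ((!) es) X"
  by (rule inj_onI) (use es_inj in blast)

lemma E_eq: "E = (!) es ` {..<n}"
  using lists(3) length_es unfolding enumerates_def set_conv_nth by auto

lemma endpoints:
  assumes "j < n"
  shows "fst (es ! j) \<in> set us" "snd (es ! j) \<in> set vs"
proof -
  have "es ! j \<in> L \<times> R"
    using assms E_eq graph by (auto simp: bipartite_graph_def)
  then show "fst (es ! j) \<in> set us" "snd (es ! j) \<in> set vs"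
    using lists by (auto simp: enumerates_def)
qed

lemma distinct_us: "distinct us" "distinct vs"
  using lists by (auto simp: enumerates_def)

text \<open>The vertex loop runs up to the number of edges; because both sides have at most
  \<open>n\<close> vertices, it visits every vertex number.\<close>

lemma position_less_n:
  assumes "j < n"
  shows "position us (fst (es ! j)) < n" "position vs (snd (es ! j)) < n"
proof -
  have "length us = card L" "length vs = card R"
    using lists distinct_card[of us] distinct_card[of vs] by (auto simp: enumerates_def)
  then show "position us (fst (es ! j)) < n" "position vs (snd (es ! j)) < n"
    using position_nth(1)[OF distinct_us(1) endpoints(1)[OF assms]]
      position_nth(1)[OF distinct_us(2) endpoints(2)[OF assms]] card_L card_R by linarith+
qed

abbreviation edges :: "nat set \<Rightarrow> ('v \<times> 'v) set" where
  "edges X \<equiv> (!) es ` X"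

lemma card_edges: "X \<subseteq> {..<n} \<Longrightarrow> card (edges X) = card X"
  using inj_on_es by (rule card_image)

lemma deg_eq:
  assumes "X \<subseteq> {..<n}"
  shows "deg 0 X v = card {j \<in> X. position us (fst (es ! j)) = v}"
    "deg 1 X v = card {j \<in> X. position vs (snd (es ! j)) = v}"
    "i \<in> {1..T} \<Longrightarrow> deg 2 X i = card (edges X \<inter> S i)"
proof -
  show "deg 0 X v = card {j \<in> X. position us (fst (es ! j)) = v}"
    unfolding deg_def using assms inp(1) by (intro arg_cong[where f = card]) auto
  show "deg 1 X v = card {j \<in> X. position vs (snd (es ! j)) = v}"
    unfolding deg_def using assms inp(2) by (intro arg_cong[where f = card]) (auto simp: numeral_3_eq_3)
  show "deg 2 X i = card (edges X \<inter> S i)" if "i \<in> {1..T}"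
  proof -
    have "inp (3 * j + 2 + 2) = i \<longleftrightarrow> es ! j \<in> S i" if "j < n" for j
    proof -
      have "3 * j + 2 + 2 = 3 * j + 4"
        by simp
      then show ?thesis
        using inp(3)[OF that] set_number_eq_iff[OF disjoint \<open>i \<in> {1..T}\<close>] by (simp only:)
    qed
    then have "{j \<in> X. j < n \<and> inp (3 * j + 2 + 2) = i} = {j \<in> X. es ! j \<in> S i}"
      using assms by auto
    then have "deg 2 X i = card {j \<in> X. es ! j \<in> S i}"
      unfolding deg_def by simp
    also have "\<dots> = card (edges {j \<in> X. es ! j \<in> S i})"
      using assms by (intro card_edges[symmetric]) auto
    also have "edges {j \<in> X. es ! j \<in> S i} = edges X \<inter> S i"
      by auto
    finally show ?thesis .
  qed
qed

lemma size_upto_eq: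
  assumes "X \<subseteq> {..<n}"
  shows "size_upto X n = card X"
proof -
  have fin: "finite X"
    using assms(1) finite_subset by blast
  have "size_upto X n = card (\<Union>v<n. {j \<in> X. position us (fst (es ! j)) = v})"
    unfolding size_upto_def deg_eq(1)[OF assms] using fin by (subst card_UN_disjoint) auto
  also have "(\<Union>v<n. {j \<in> X. position us (fst (es ! j)) = v}) = X"
    using assms position_less_n by auto
  finally show ?thesis .
qed

lemma conflicts_matching:
  assumes "X \<subseteq> {..<n}" "matching E (edges X)"
  shows "conflicts_upto X n = 0"
proof -
  have fin: "finite X"
    using assms(1) finite_subset by blast
  have same: "i = j" if "i \<in> X" "j \<in> X" "fst (es ! i) = fst (es ! j) \<or> snd (es ! i) = snd (es ! j)" for i j
  proof -
    have "es ! i = es ! j"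
      using that by (intro matching_unique[OF assms(2)]) auto
    then show ?thesis
      using that(1,2) assms(1) es_inj by auto
  qed
  have "deg 0 X v \<le> Suc 0" for v
  proof -
    have "i = j" if "i \<in> X" "j \<in> X" "position us (fst (es ! i)) = v" "position us (fst (es ! j)) = v" for i j
    proof -
      have "fst (es ! i) = fst (es ! j)"
        using that assms(1) endpoints(1)[of i] endpoints(1)[of j]
          position_eq_iff[OF distinct_us(1), of "fst (es ! i)" "fst (es ! j)"] by auto
      then show ?thesis
        using same[OF that(1,2)] by simp
    qed
    then show ?thesis
      unfolding deg_eq(1)[OF assms(1)] using fin by (subst card_le_Suc0_iff_eq) auto
  qed
  moreover have "deg 1 X v \<le> Suc 0" for v
  proof -
    have "i = j" if "i \<in> X" "j \<in> X" "position vs (snd (es ! i)) = v" "position vs (snd (es ! j)) = v" for i j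
    proof -
      have "snd (es ! i) = snd (es ! j)"
        using that assms(1) endpoints(2)[of i] endpoints(2)[of j]
          position_eq_iff[OF distinct_us(2), of "snd (es ! i)" "snd (es ! j)"] by auto
      then show ?thesis
        using same[OF that(1,2)] by simp
    qed
    then show ?thesis
      unfolding deg_eq(2)[OF assms(1)] using fin by (subst card_le_Suc0_iff_eq) auto
  qed
  ultimately have "deg 0 X v - 1 = 0" "deg 1 X v - 1 = 0" for v
    by simp_all
  then show ?thesis
    by (simp add: conflicts_upto_def)
qed

lemma two_le_card: "finite A \<Longrightarrow> i \<in> A \<Longrightarrow> j \<in> A \<Longrightarrow> i \<noteq> j \<Longrightarrow> 2 \<le> card A"
  using card_mono[of A "{i, j}"] by simp

text \<open>Two clashing edges give some vertex degree at least 2, and a single charge of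
  \<open>W * n\<close> already outweighs any possible gain.\<close>

lemma conflicts_not_matching:
  assumes "X \<subseteq> {..<n}" "\<not> matching E (edges X)"
  shows "W * n \<le> conflicts_upto X n"
proof -
  have fin: "finite X"
    using assms(1) finite_subset by blast
  have "edges X \<subseteq> E"
    using assms(1) E_eq by blast
  then obtain i j where ij: "i \<in> X" "j \<in> X" "es ! i \<noteq> es ! j"
    "fst (es ! i) = fst (es ! j) \<or> snd (es ! i) = snd (es ! j)"
    using assms(2) unfolding matching_def by blast
  have "i < n" "i \<noteq> j"
    using ij assms(1) by auto
  have "\<exists>v<n. 2 \<le> deg 0 X v \<or> 2 \<le> deg 1 X v"
    using ij(4)
  proof
    assume "fst (es ! i) = fst (es ! j)"
    then have "2 \<le> deg 0 X (position us (fst (es ! i)))"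
      unfolding deg_eq(1)[OF assms(1)] using ij fin \<open>i \<noteq> j\<close> by (intro two_le_card[of _ i j]) auto
    then show ?thesis
      using position_less_n(1)[OF \<open>i < n\<close>] by blast
  next
    assume "snd (es ! i) = snd (es ! j)"
    then have "2 \<le> deg 1 X (position vs (snd (es ! i)))"
      unfolding deg_eq(2)[OF assms(1)] using ij fin \<open>i \<noteq> j\<close> by (intro two_le_card[of _ i j]) auto
    then show ?thesis
      using position_less_n(2)[OF \<open>i < n\<close>] by blast
  qed
  then obtain v where v: "v < n" "2 \<le> deg 0 X v \<or> 2 \<le> deg 1 X v"
    by blast
  then have "1 \<le> deg 0 X v - 1 \<or> 1 \<le> deg 1 X v - 1"
    by linarith
  then have "W * n * 1 \<le> W * n * (deg 0 X v - 1) + W * n * (deg 1 X v - 1)"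
    using mult_le_mono2[of 1 "deg 0 X v - 1" "W * n"] mult_le_mono2[of 1 "deg 1 X v - 1" "W * n"] by linarith
  also have "\<dots> \<le> conflicts_upto X n"
    unfolding conflicts_upto_def
    using v(1) member_le_sum[of v "{..<n}" "\<lambda>v. W * n * (deg 0 X v - 1) + W * n * (deg 1 X v - 1)"] by simp
  finally show ?thesis
    by simp
qed

lemma penalty_eq:
  assumes "X \<subseteq> {..<n}"
  shows "penalty_upto X T = conflicts_upto X n + overload T S (edges X)"
proof -
  have "(\<Sum>k<T. W div 2 ^ Suc k * (deg 2 X (Suc k) - 2 ^ Suc k)\<^sup>2) =
      (\<Sum>k<T. 2 ^ (T - Suc k) * (card (edges X \<inter> S (Suc k)) - 2 ^ Suc k)\<^sup>2)"
  proof (rule sum.cong)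
    fix k assume "k \<in> {..<T}"
    then have "W div 2 ^ Suc k = 2 ^ (T - Suc k)" "deg 2 X (Suc k) = card (edges X \<inter> S (Suc k))"
      using deg_eq(3)[OF assms, of "Suc k"] W by (auto simp: power_diff simp del: power_Suc)
    then show "W div 2 ^ Suc k * (deg 2 X (Suc k) - 2 ^ Suc k)\<^sup>2 =
        2 ^ (T - Suc k) * (card (edges X \<inter> S (Suc k)) - 2 ^ Suc k)\<^sup>2"
      by simp
  qed simp
  also have "\<dots> = overload T S (edges X)"
    unfolding overload_def by (simp only: sum.atLeast1_atMost_eq One_nat_def)
  finally show ?thesis
    by (simp add: penalty_upto_def)
qed

lemma score_eq:
  assumes "X \<subseteq> {..<n}"
  shows "score X = (if matching E (edges X) then W * card (edges X) - overload T S (edges X) else 0)"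
proof (cases "matching E (edges X)")
  case True
  then show ?thesis
    using conflicts_matching[OF assms] by (simp add: score_def penalty_eq assms size_upto_eq card_edges)
next
  case False
  have "W * size_upto X n \<le> W * n"
    by (intro mult_le_mono2 size_upto_le_n)
  then have "W * size_upto X n - (conflicts_upto X n + overload T S (edges X)) = 0"
    using conflicts_not_matching[OF assms False] by linarith
  then show ?thesis
    using False unfolding score_def penalty_eq[OF assms] by simp
qed

text \<open>Scores are potentials truncated at 0. The solution has a nonnegative potential, being
  empty or of positive score, so for matchings comparing scores is comparing potentials. Every
  matching within distance \<open>K\<close> is reached by some move.\<close>

lemma local_opt_edges:
  assumes X: "X \<subseteq> {..<n}" "X = {} \<or> 0 < score X"
    and opt: "\<And>c. c < B \<Longrightarrow> score (sym_diff X (flipped c)) \<le> score X"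
  shows "local_opt K E T S (edges X)"
  unfolding local_opt_def
proof (intro conjI allI impI)
  show M: "matching E (edges X)"
  proof (cases "X = {}")
    case True
    then show ?thesis
      by (simp add: matching_def)
  next
    case False
    then show ?thesis
      using X score_eq[OF X(1)] by (auto split: if_splits)
  qed
  have le: "overload T S (edges X) \<le> W * card (edges X)"
  proof (cases "X = {}")
    case True
    then show ?thesis
      by (simp add: overload_def)
  next
    case False
    then show ?thesis
      using X score_eq[OF X(1)] by (auto split: if_splits)
  qed
  fix M' assume M': "matching E M' \<and> card (sym_diff (edges X) M') \<le> K"
  define Y where "Y = {j. j < n \<and> es ! j \<in> M'}"
  have Y: "Y \<subseteq> {..<n}"
    by (auto simp: Y_def)
  have "M' \<subseteq> E"
    using M' by (simp add: matching_def)
  then have edges_Y: "edges Y = M'"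
    using E_eq by (auto simp: Y_def)
  have XY: "sym_diff X Y \<subseteq> {..<n}"
    using X(1) Y by auto
  have "edges (X - Y) = edges X - edges Y" "edges (Y - X) = edges Y - edges X"
    using inj_on_image_set_diff[OF inj_on_es[OF order_refl]] X(1) Y by blast+
  then have "edges (sym_diff X Y) = sym_diff (edges X) (edges Y)"
    by (simp add: image_Un)
  then have "card (sym_diff X Y) \<le> K"
    using M' edges_Y card_edges[OF XY] by simp
  then obtain c where c: "c < B" "flipped c = sym_diff X Y"
    using flipped_surj[OF XY] by blast
  have "sym_diff X (flipped c) = Y"
    unfolding c(2) by auto
  then have "score Y \<le> score X"
    using opt[OF c(1)] by simp
  then have "W * card M' - overload T S M' \<le> W * card (edges X) - overload T S (edges X)"
    using M M' edges_Y by (simp add: score_eq X(1) Y)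
  then show "2 ^ T * card M' + overload T S (edges X) \<le> 2 ^ T * card (edges X) + overload T S M'"
    unfolding W[symmetric] using le by linarith
qed

end

section \<open>Word length and running time\<close>

text \<open>A purely integral description of the rounded-up logarithm, in the form of the loop test
  of the setup. It includes \<open>n = 0\<close>, where \<open>log 2 0 = 0\<close>.\<close>

lemma two_power_less_iff: "2 ^ t < n \<longleftrightarrow> t < nat \<lceil>log 2 (real n)\<rceil>"
proof (cases "n = 0")
  case False
  have "2 ^ t < n \<longleftrightarrow> (2::real) ^ t < real n"
    by (metis of_nat_less_iff of_nat_numeral of_nat_power)
  also have "\<dots> \<longleftrightarrow> real t < log 2 (real n)"
    using False less_log_iff[of 2 "real n" "real t"] by (simp add: powr_realpow)
  also have "\<dots> \<longleftrightarrow> t < nat \<lceil>log 2 (real n)\<rceil>"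
    by (simp add: zless_nat_eq_int_zless less_ceiling_iff)
  finally show ?thesis .
qed (simp add: log_def)

lemma power_le_two_power_word_length: "(n + 2) ^ k \<le> 2 ^ word_length k n"
proof -
  have "\<not> (2::nat) ^ nat \<lceil>log 2 (real (n + 2))\<rceil> < n + 2"
    using two_power_less_iff[of "nat \<lceil>log 2 (real (n + 2))\<rceil>" "n + 2"] by blast
  then have "(n + 2) ^ k \<le> (2 ^ nat \<lceil>log 2 (real (n + 2))\<rceil>) ^ k"
    by (intro power_mono) auto
  then show ?thesis
    by (simp add: word_length_def mult.commute add.commute flip: power_mult)
qed

text \<open>All quantities are dominated by powers of \<open>n + 2\<close> with exponent at most
  \<open>N0 + K0 + 20\<close>, which this word length accommodates; as the base is at least 2, even
  the literals \<open>N0\<close> and \<open>K0\<close> fit. In \<open>W \<le> 2 * n + 1\<close> the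
  summand 1 covers \<open>n = 0\<close>.\<close>

lemma word_bounds:
  fixes n N0 K0 :: nat
  defines "w \<equiv> word_length (N0 + K0 + 20) n" and "W \<equiv> 2 ^ nat \<lceil>log 2 (real n)\<rceil>"
    and "K \<equiv> if n < N0 then N0 else K0"
  shows "5 * n + 10 < 2 ^ w" "4 * n * (W * n * n) + 2 * W < 2 ^ w" "nat \<lceil>log 2 (real n)\<rceil> \<le> n"
    "(n + 1) ^ K < 2 ^ w" "N0 < 2 ^ w" "K0 < 2 ^ w" "W \<le> 2 * n + 1"
proof -
  let ?T = "nat \<lceil>log 2 (real n)\<rceil>"
  have pow: "(n + 2) ^ l \<le> 2 ^ w" if "l \<le> N0 + K0 + 20" for l
    using power_increasing[OF that, of "n + 2"] power_le_two_power_word_length[of n "N0 + K0 + 20"]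
    unfolding w_def by linarith
  have pow2: "(2::nat) ^ l \<le> (n + 2) ^ l" for l
    by (intro power_mono) auto
  have "5 * n + 10 < (n + 2) * 8"
    by simp
  also have "\<dots> \<le> (n + 2) * (n + 2) ^ 3"
    using pow2[of 3] by (intro mult_le_mono2) simp
  also have "\<dots> = (n + 2) ^ 4"
    by (simp add: numeral_eq_Suc)
  also have "\<dots> \<le> 2 ^ w"
    by (rule pow) simp
  finally show "5 * n + 10 < 2 ^ w" .
  show "?T \<le> n"
    using two_power_less_iff[of n n] less_exp[of n] by linarith
  show W_le: "W \<le> 2 * n + 1"
  proof (cases "?T")
    case (Suc t)
    then have "2 ^ t < n"
      using two_power_less_iff[of t n] by simp
    then show ?thesis
      unfolding W_def Suc by simp
  qed (simp add: W_def)
  \<comment> \<open>The left side is at most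
    \<open>8 * x ^ 4 + 4 * x < 16 * x ^ 4 \<le> x ^ 8\<close>.\<close>
  define x where "x = n + 2"
  have "4 * n * (W * n * n) \<le> 4 * x * (2 * x * x * x)"
    using W_le by (intro mult_le_mono) (auto simp: x_def)
  moreover have "2 * W \<le> 4 * x"
    using W_le by (simp add: x_def)
  moreover have "x \<le> x ^ 4"
    by (intro self_le_power) (auto simp: x_def)
  moreover have "4 * x * (2 * x * x * x) = 8 * x ^ 4"
    by (simp only: power4_eq_xxxx ac_simps)
  moreover have "16 * x ^ 4 \<le> x ^ 4 * x ^ 4"
    using pow2[of 4] unfolding x_def by (intro mult_le_mono1) simp
  moreover have "x ^ 4 * x ^ 4 \<le> 2 ^ w"
    using pow[of 8] unfolding x_def by (simp flip: power_add)
  moreover have "x ^ 4 > 0"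
    by (simp add: x_def)
  ultimately show "4 * n * (W * n * n) + 2 * W < 2 ^ w"
    by linarith
  have "(n + 1) ^ K \<le> (n + 2) ^ K"
    by (intro power_mono) auto
  also have "\<dots> < (n + 2) ^ Suc K"
    by (intro power_strict_increasing) auto
  also have "\<dots> \<le> 2 ^ w"
    by (rule pow) (simp add: K_def)
  finally show "(n + 1) ^ K < 2 ^ w" .
  show "N0 < 2 ^ w" "K0 < 2 ^ w"
    using less_exp[of N0] pow2[of N0] pow[of N0] less_exp[of K0] pow2[of K0] pow[of K0] by linarith+
qed

definition running_time :: "nat \<Rightarrow> nat \<Rightarrow> nat \<Rightarrow> nat" where
  "running_time N0 K0 n = (let W = 2 ^ nat \<lceil>log 2 (real n)\<rceil>; K = (if n < N0 then N0 else K0) in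
     28 * n + 14 * K + 56 + ((W * n + 1) * ((n + 1) ^ K + 1) * (130 * (n + 1)\<^sup>2 + 40 * K + 24) + 4))"

text \<open>The exponent is \<open>2 + K0 + 2\<close>: number of phases, moves per phase, cost of a
  trial. The constant 544 is \<open>130 * 4 + 24\<close>, from \<open>n + 1 \<le> 2 * n\<close>, and
  88 collects \<open>28 + 60\<close> from the lower-order terms.\<close>

lemma running_time_le:
  assumes "N0 \<le> n" "1 \<le> n"
  shows "running_time N0 K0 n \<le> (4 * 2 ^ (K0 + 1) * (544 + 40 * K0) + 88 + 14 * K0) * n ^ (K0 + 4)"
proof -
  let ?W = "2 ^ nat \<lceil>log 2 (real n)\<rceil> :: nat"
  have "?W \<le> 2 * n + 1"
    using word_bounds(7) .
  then have "?W * n + 1 \<le> (2 * n + 1) * n + n * n"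
    using assms(2) by (intro add_mono mult_le_mono1) auto
  also have "\<dots> \<le> 4 * n ^ 2"
    using assms(2) by (simp add: power2_eq_square algebra_simps)
  finally have 1: "?W * n + 1 \<le> 4 * n ^ 2" .
  have "(n + 1) ^ K0 + 1 \<le> (2 * n) ^ K0 + (2 * n) ^ K0"
    using assms(2) by (intro add_mono power_mono one_le_power) auto
  also have "\<dots> = 2 ^ (K0 + 1) * n ^ K0"
    by (simp add: power_mult_distrib)
  finally have 2: "(n + 1) ^ K0 + 1 \<le> 2 ^ (K0 + 1) * n ^ K0" .
  have "(n + 1)\<^sup>2 \<le> (2 * n)\<^sup>2"
    using assms(2) by (intro power_mono) auto
  moreover have "1 \<le> n\<^sup>2"
    using assms(2) by simp
  then have "40 * K0 + 24 \<le> (40 * K0 + 24) * n\<^sup>2"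
    by simp
  ultimately have 3: "130 * (n + 1)\<^sup>2 + 40 * K0 + 24 \<le> (544 + 40 * K0) * n ^ 2"
    by (simp add: power_mult_distrib algebra_simps)
  have "(?W * n + 1) * ((n + 1) ^ K0 + 1) * (130 * (n + 1)\<^sup>2 + 40 * K0 + 24) \<le>
      4 * n ^ 2 * (2 ^ (K0 + 1) * n ^ K0) * ((544 + 40 * K0) * n ^ 2)"
    using 1 2 3 by (intro mult_le_mono)
  also have "\<dots> = 4 * 2 ^ (K0 + 1) * (544 + 40 * K0) * n ^ (K0 + 4)"
    by (simp add: power_add power2_eq_square power4_eq_xxxx)
  finally have "running_time N0 K0 n \<le> 4 * 2 ^ (K0 + 1) * (544 + 40 * K0) * n ^ (K0 + 4) + (28 * n + 14 * K0 + 60)"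
    using assms(1) by (simp add: running_time_def Let_def)
  also have "28 * n + 14 * K0 + 60 \<le> (88 + 14 * K0) * n ^ (K0 + 4)"
  proof -
    have "n \<le> n ^ (K0 + 4)" "1 \<le> n ^ (K0 + 4)"
      using assms(2) by (auto intro: self_le_power)
    then have "28 * n \<le> 28 * n ^ (K0 + 4)" "(14 * K0 + 60) * 1 \<le> (14 * K0 + 60) * n ^ (K0 + 4)"
      by (auto intro: mult_le_mono2)
    then show ?thesis
      by (simp add: algebra_simps)
  qed
  finally show ?thesis
    by (simp add: algebra_simps)
qed

lemma running_time_bigo:
  assumes "real (K0 + 4) \<le> p"
  shows "(\<lambda>n. real (running_time N0 K0 n)) \<in> O(\<lambda>n. real n powr p)"
proof (rule bigoI)
  let ?C = "4 * 2 ^ (K0 + 1) * (544 + 40 * K0) + 88 + 14 * K0"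
  show "\<forall>\<^sub>F n in at_top. norm (real (running_time N0 K0 n)) \<le> real ?C * norm (real n powr p)"
    using eventually_ge_at_top[of "max N0 1"]
  proof eventually_elim
    case (elim n)
    then have n: "N0 \<le> n" "1 \<le> n"
      by auto
    have "real (running_time N0 K0 n) \<le> real ?C * real n ^ (K0 + 4)"
      using of_nat_mono[OF running_time_le[OF n], where ?'a = real] by (simp only: of_nat_mult of_nat_power)
    also have "real n ^ (K0 + 4) = real n powr real (K0 + 4)"
      using n(2) by (subst powr_realpow) auto
    also have "\<dots> \<le> real n powr p"
      using assms n(2) by (intro powr_mono) auto
    finally show ?case
      by (simp add: mult_left_mono)
  qed
qed

section \<open>Quality of local optima and the final assembly\<close>

lemma matching_card_le:
  assumes "bipartite_graph L R E" "matching E M"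
  shows "card M \<le> card L"
proof -
  have "inj_on fst M"
    by (rule inj_onI) (use assms(2) matching_unique in blast)
  moreover have "fst ` M \<subseteq> L"
    using assms by (force simp: bipartite_graph_def matching_def)
  ultimately show ?thesis
    using assms(1) card_inj_on_le by (auto simp: bipartite_graph_def)
qed

text \<open>A bipartite graph with \<open>m\<close> vertices per side has at most
  \<open>m * m\<close> edges, so \<open>m\<close> is at least the square root of \<open>n\<close>,
  which outgrows the logarithm.\<close>

lemma eventually_sets_negligible:
  fixes c \<epsilon> :: real
  assumes "0 < c" "0 < \<epsilon>"
  obtains N0 where "\<And>n m. N0 \<le> n \<Longrightarrow> n \<le> m * m \<Longrightarrow> c * real (nat \<lceil>log 2 (real n)\<rceil>) \<le> \<epsilon> * real m"
proof -
  have "((\<lambda>n. (log 2 (real n) + 1) / sqrt (real n)) \<longlongrightarrow> 0) sequentially"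
    by real_asymp
  then have "\<forall>\<^sub>F n in sequentially. (log 2 (real n) + 1) / sqrt (real n) < \<epsilon> / c"
    using assms by (intro order_tendstoD) auto
  then obtain N where N: "\<And>n. N \<le> n \<Longrightarrow> (log 2 (real n) + 1) / sqrt (real n) < \<epsilon> / c"
    by (auto simp: eventually_sequentially)
  show thesis
  proof (rule that[of "max N 1"])
    fix n m :: nat
    assume n: "max N 1 \<le> n" "n \<le> m * m"
    have "real (nat \<lceil>log 2 (real n)\<rceil>) \<le> log 2 (real n) + 1"
      using n(1) by (simp add: of_nat_nat zero_le_log_cancel_iff le_ceiling_iff)
    also have "\<dots> \<le> \<epsilon> / c * sqrt (real n)"
      using N[of n] n(1) by (simp add: divide_less_eq)
    also have "\<dots> \<le> \<epsilon> / c * real m"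
    proof (rule mult_left_mono)
      have "real n \<le> (real m)\<^sup>2"
        using of_nat_mono[OF n(2), where ?'a = real] by (simp add: power2_eq_square)
      then show "sqrt (real n) \<le> real m"
        by (intro real_le_lsqrt) auto
    qed (use assms in auto)
    finally show "c * real (nat \<lceil>log 2 (real n)\<rceil>) \<le> \<epsilon> * real m"
      using assms(1) by (simp add: field_simps)
  qed
qed

text \<open>In the second alternative the loss splits into two halves of
  \<open>\<epsilon> * m\<close>: one for the window boundaries, via
  \<open>1 / q \<le> \<epsilon> / 2\<close> and \<open>card M \<le> m\<close>, the other for the
  second-order terms. The first alternative loses nothing.\<close>

lemma local_opt_nearly_matching:
  assumes graph: "bipartite_graph L R E" "card L = m"
    and N: "perfect_matching L R E N" "valid 1 T S N"
    and opt: "local_opt K E T S M"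
    and K: "1 \<le> q" "2 / \<epsilon> \<le> real q" "card E \<le> K \<or> 3 * q \<le> K \<and> 15 * real q * real T \<le> \<epsilon> / 2 * real m"
    and \<epsilon>: "0 < \<epsilon>"
  shows "nearly_matching \<epsilon> m E M"
proof -
  have M: "matching E M"
    using opt by (simp add: local_opt_def)
  have "(1 - \<epsilon>) * real m \<le> real (card M)"
    using K(3)
  proof
    assume "card E \<le> K"
    moreover have "finite E"
      using graph(1) finite_subset by (auto simp: bipartite_graph_def)
    moreover have "card L \<le> card N"
      using N(1) card_image_le[of N fst] \<open>finite E\<close> finite_subset
      by (auto simp: perfect_matching_def matching_def)
    ultimately have "m \<le> card M"
      using global_opt_card_ge[OF _ opt _ _ N(2)] N(1) graph(2) by (force simp: perfect_matching_def)
    moreover have "(1 - \<epsilon>) * real m \<le> 1 * real m"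
      using \<epsilon> by (intro mult_right_mono) auto
    ultimately show ?thesis
      by linarith
  next
    assume *: "3 * q \<le> K \<and> 15 * real q * real T \<le> \<epsilon> / 2 * real m"
    have "1 / real q \<le> \<epsilon> / 2"
      using K(1,2) \<epsilon> by (simp add: field_simps)
    then have "1 / real q * real (card M) \<le> \<epsilon> / 2 * real m"
      using matching_card_le[OF graph(1) M] graph(2) \<epsilon> by (intro mult_mono) auto
    moreover have "real m \<le> (1 + 1 / real q) * real (card M) + 15 * real q * real T"
      using local_opt_card_ge[OF graph(1) N opt K(1)] * graph(2) by simp
    ultimately show ?thesis
      using * unfolding distrib_right left_diff_distrib by linarith
  qed
  then show ?thesis
    using M by (simp add: nearly_matching_def)
qed

lemma search_finds_local_opt:
  fixes L R :: "'v set" and S us vs es N0 K0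
  assumes graph: "bipartite_graph L R E" "card L = m" "card R = m" "card E = n" and T: "T = nat \<lceil>log 2 (real n)\<rceil>"
    and disjoint: "disjoint_family_on S {1..T}" and "m \<le> n"
    and lists: "enumerates us L" "enumerates vs R" "enumerates es E"
  shows "reaches (word_length (N0 + K0 + 20) n) (search_prog N0 K0) (initial_state (encode_instance us vs es T S))
    (running_time N0 K0 n) (\<lambda>s. local_opt (if n < N0 then N0 else K0) E T S (output_edges es s))"
proof -
  define w where "w = word_length (N0 + K0 + 20) n"
  define K where "K = (if n < N0 then N0 else K0)"
  define mem where "mem = snd (initial_state (encode_instance us vs es T S))"
  define W :: nat where "W = 2 ^ T"
  have len: "length es = n"
    using lists(3) graph(4) distinct_card[of es] by (simp add: enumerates_def)
  have mem: "mem a = (if a < 3 * n + 2 then encode_instance us vs es T S ! a else 0)" for a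
    using len length_concat_triples[of "\<lambda>e. position us (fst e)" "\<lambda>e. position vs (snd e)" "set_number T S" es]
    by (simp add: mem_def initial_state_def encode_instance_def)
  have cell: "mem (3 * j + 2 + f) = [position us (fst (es ! j)), position vs (snd (es ! j)), set_number T S (es ! j)] ! f"
    if "j < n" "f < 3" for j f
  proof -
    have "mem (3 * j + 2 + f) = encode_instance us vs es T S ! (2 + (3 * j + f))"
      using that by (simp add: mem)
    also have "\<dots> = concat (map (\<lambda>e. [position us (fst e), position vs (snd e), set_number T S e]) es) ! (3 * j + f)"
      by (simp add: encode_instance_def)
    finally show ?thesis
      using nth_concat_triples[of j es f] that len by simp
  qed
  have K_less: "K < 2 ^ w"
    using word_bounds(5)[of N0 K0 n] word_bounds(6)[of K0 N0 n] by (simp add: K_def w_def)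
  interpret encoded_instance w n T W K "(n + 1) ^ K" mem L R E S us vs es
  proof unfold_locales
    show "mem (3 * j + 2) = position us (fst (es ! j))" "mem (3 * j + 3) = position vs (snd (es ! j))"
      "mem (3 * j + 4) = set_number T S (es ! j)" if "j < n" for j
      using cell[OF that, of 0] cell[OF that, of 1] cell[OF that, of 2] by (simp_all add: numeral_eq_Suc)
    show "5 * n + 10 < 2 ^ w" "4 * n * (W * n * n) + 2 * W < 2 ^ w" "T \<le> n" "(n + 1) ^ K < 2 ^ w"
      using word_bounds(1,2,4)[where ?N0.0 = N0 and ?K0.0 = K0 and n = n] word_bounds(3)[of n] by (simp_all only: T W_def K_def w_def)
  qed (use graph lists disjoint \<open>m \<le> n\<close> K_less in \<open>auto simp: W_def\<close>)
  have time: "28 * n + 14 * K + 56 + search_time = running_time N0 K0 n"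
    unfolding search_time_def running_time_def Let_def unfolding K_def W_def T by simp
  have mem1: "mem 1 = n"
    using len by (simp add: mem) (simp add: encode_instance_def)
  have search: "reaches w (search_prog N0 K0) (\<lambda>_. 0, mem) (28 * n + 14 * K + 56 + search_time)
    (\<lambda>(rg', mem'). \<exists>X\<subseteq>{..<n}. (\<forall>j<n. mem' j = of_bool (j \<in> X)) \<and> (X = {} \<or> 0 < score X) \<and>
      (\<forall>c<(n + 1) ^ K. score (sym_diff X (flipped c)) \<le> score X))"
    by (rule reaches_search)
      (use two_power_less_iff word_bounds(5)[of N0 K0 n] word_bounds(6)[of K0 N0 n] mem1 mem in \<open>auto simp: T K_def w_def\<close>)
  have init: "initial_state (encode_instance us vs es T S) = (\<lambda>_. 0, mem)"
    by (simp add: mem_def initial_state_def)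
  show ?thesis
    unfolding init w_def[symmetric] K_def[symmetric]
  proof (rule reaches_mono[OF search[unfolded time] order_refl])
    fix s :: state
    assume "case s of (rg', mem') \<Rightarrow> \<exists>X\<subseteq>{..<n}. (\<forall>j<n. mem' j = of_bool (j \<in> X)) \<and> (X = {} \<or> 0 < score X) \<and>
      (\<forall>c<(n + 1) ^ K. score (sym_diff X (flipped c)) \<le> score X)"
    then obtain X where X: "X \<subseteq> {..<n}" "\<forall>j<n. snd s j = of_bool (j \<in> X)" "X = {} \<or> 0 < score X"
      "\<And>c. c < (n + 1) ^ K \<Longrightarrow> score (sym_diff X (flipped c)) \<le> score X"
      by (cases s) auto
    have "X = {j. j < n \<and> snd s j \<noteq> 0}"
      using X(1,2) by auto
    then have "output_edges es s = edges X"
      unfolding output_edges_def len by blast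
    then show "local_opt K E T S (output_edges es s)"
      using local_opt_edges[OF X(1,3,4)] by simp
  qed
qed

theorem theorem9p3:
  fixes \<delta> \<epsilon> :: real
  assumes "0 < \<delta>" "\<delta> < 1" "0 < \<epsilon>" "\<epsilon> < 1"
  shows "\<exists>(P :: prog) (k :: nat) (f :: nat \<Rightarrow> real).
    k \<ge> 1 \<and> f \<in> O(\<lambda>n. real n powr (18 / (\<delta> * \<epsilon>))) \<and>
    (\<forall>(L :: nat set) (R :: nat set) (E :: (nat \<times> nat) set) (S :: nat \<Rightarrow> (nat \<times> nat) set)
       (m :: nat) (n :: nat) (T :: nat) us vs es.
      bipartite_graph L R E \<and> card L = m \<and> card R = m \<and> card E = n \<and>
      T = nat \<lceil>log 2 (real n)\<rceil> \<and>
      (\<forall>i\<in>{1..T}. S i \<subseteq> E) \<and> disjoint_family_on S {1..T} \<and>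
      (\<exists>M. perfect_matching L R E M \<and> valid 1 T S M) \<and>
      enumerates us L \<and> enumerates vs R \<and> enumerates es E \<longrightarrow>
      (\<exists>t s. exec (word_length k n) P (initial_state (encode_instance us vs es T S)) t s \<and>
         real t \<le> f n \<and>
         nearly_matching \<epsilon> m E (output_edges es s) \<and>
         valid (2 + \<delta>) T S (output_edges es s)))"
proof -
  define q where "q = nat \<lceil>2 / \<epsilon>\<rceil>"
  have q: "2 / \<epsilon> \<le> real q" "real q \<le> 2 / \<epsilon> + 1" "1 \<le> q"
  proof -
    have "0 < 2 / \<epsilon>"
      using assms(3) by simp
    then show "2 / \<epsilon> \<le> real q" "real q \<le> 2 / \<epsilon> + 1" "1 \<le> q"
      unfolding q_def by linarith+
  qed
  obtain N0 where N0: "\<And>n m. N0 \<le> n \<Longrightarrow> n \<le> m * m \<Longrightarrow>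
      15 * real q * real (nat \<lceil>log 2 (real n)\<rceil>) \<le> \<epsilon> / 2 * real m"
    using eventually_sets_negligible[of "15 * real q" "\<epsilon> / 2"] q(3) assms(3) by auto
  \<comment> \<open>Rounding \<open>2 / \<epsilon>\<close> up costs at most 3 in
    \<open>3 * q\<close>; then \<open>7 \<le> 12 / \<epsilon>\<close> because
    \<open>\<epsilon> < 1\<close>, and dividing by \<open>\<delta> < 1\<close> only enlarges the
    exponent.\<close>
  have "real (3 * q + 4) \<le> 6 / \<epsilon> + 7"
    using q(2) by simp
  also have "\<dots> \<le> 18 / \<epsilon>"
    using assms(3,4) by (simp add: field_simps)
  also have "\<dots> \<le> 18 / (\<delta> * \<epsilon>)"
    using assms by (intro divide_left_mono) (auto simp: mult_le_cancel_right1)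
  finally have "(\<lambda>n. real (running_time N0 (3 * q) n)) \<in> O(\<lambda>n. real n powr (18 / (\<delta> * \<epsilon>)))"
    by (rule running_time_bigo)
  moreover have "\<exists>t s. exec (word_length (N0 + 3 * q + 20) n) (search_prog N0 (3 * q))
        (initial_state (encode_instance us vs es T S)) t s \<and>
      real t \<le> real (running_time N0 (3 * q) n) \<and>
      nearly_matching \<epsilon> m E (output_edges es s) \<and> valid (2 + \<delta>) T S (output_edges es s)"
    if graph: "bipartite_graph L R E" "card L = m" "card R = m" "card E = n" and T: "T = nat \<lceil>log 2 (real n)\<rceil>"
      and disjoint: "disjoint_family_on S {1..T}"
      and N: "perfect_matching L R E N" "valid 1 T S N"
      and lists: "enumerates us L" "enumerates vs R" "enumerates es E"
    for L R :: "nat set" and E S m n T us vs es N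
  proof -
    have finE: "finite E"
      using graph(1) finite_subset by (auto simp: bipartite_graph_def)
    have NE: "N \<subseteq> E" "fst ` N = L"
      using N(1) by (auto simp: perfect_matching_def matching_def)
    then have "m \<le> card N"
      using card_image_le[OF finite_subset[OF NE(1) finE], of fst] graph(2) by simp
    then have mn: "m \<le> n"
      using card_mono[OF finE NE(1)] graph(4) by linarith
    have "card E \<le> card (L \<times> R)"
      using graph(1) by (intro card_mono) (auto simp: bipartite_graph_def)
    then have nm: "n \<le> m * m"
      using graph by (simp add: card_cartesian_product)
    let ?K = "if n < N0 then N0 else 3 * q"
    obtain t s where run: "exec (word_length (N0 + 3 * q + 20) n) (search_prog N0 (3 * q))
        (initial_state (encode_instance us vs es T S)) t s" "t \<le> running_time N0 (3 * q) n"
      and opt: "local_opt ?K E T S (output_edges es s)"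
      using search_finds_local_opt[OF graph T disjoint mn lists, of N0 "3 * q"] unfolding reaches_def by blast
    \<comment> \<open>Below \<open>N0\<close> the move size is \<open>N0 > n\<close>, so the optimum
      is global; from \<open>N0\<close> on the second-order loss is negligible.\<close>
    have "card E \<le> ?K \<or> 3 * q \<le> ?K \<and> 15 * real q * real T \<le> \<epsilon> / 2 * real m"
      using N0[OF _ nm] graph(4) T by auto
    then have "nearly_matching \<epsilon> m E (output_edges es s)"
      by (rule local_opt_nearly_matching[OF graph(1,2) N opt q(3,1) _ assms(3)])
    moreover have "valid (2 + \<delta>) T S (output_edges es s)"
      unfolding valid_def
    proof
      fix i assume i: "i \<in> {1..T}"
      have "1 \<le> ?K"
        using q(3) by auto
      then have "card (output_edges es s \<inter> S i) \<le> 2 * 2 ^ i"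
        by (rule local_opt_card_le[OF finE opt _ i])
      then have "real (card (output_edges es s \<inter> S i)) \<le> 2 * 2 ^ i"
        using of_nat_mono[where ?'a = real] by fastforce
      also have "\<dots> \<le> (2 + \<delta>) * 2 ^ i"
        using assms(1) by (intro mult_right_mono) auto
      finally show "real (card (output_edges es s \<inter> S i)) \<le> (2 + \<delta>) * 2 ^ i" .
    qed
    ultimately show ?thesis
      using run by (intro exI[of _ t] exI[of _ s]) simp
  qed
  ultimately show ?thesis
    by (intro exI[of _ "search_prog N0 (3 * q)"] exI[of _ "N0 + 3 * q + 20"]
        exI[of _ "\<lambda>n. real (running_time N0 (3 * q) n)"]) auto
qed

end
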